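(* Let $\mu$ be a finite positive Borel measure on $\mathbb{T}$ and let $E\subset\mathbb{T}$ be a closed set of Lebesgue measure zero. If $$\int_0^\pi\frac{dt}{\int_0^t(\rho_\mu(s)N_E(s)/s)\,ds}=+\infty,$$ then $c_\mu(E)=0$.
   Context: $\mathbb{T}$ is the unit circle; $L^2(\mathbb{T})$ is taken with respect to $dt/2\pi$. For $f\in L^2(\mathbb{T})$ put $$\mathcal{D}_\mu(f)=\int_{\mathbb{T}}\left(\int_{\mathbb{T}}\frac{|f(e^{it})-f(\xi)|^2}{|e^{it}-\xi|^2}\frac{dt}{2\pi}\right)d\mu(\xi),$$ where $f(\xi)$ is the non-tangential limit at $\xi$ of the Poisson integral of $f$ (the inner integral is $+\infty$ where this limit does not exist), and $\mathcal{D}^h(\mu)=\{f\in L^2(\mathbb{T}):\|f\|_\mu^2:=\|f\|_{L^2(\mathbb{T})}^2+\mathcal{D}_\mu(f)<\infty\}$. For $U\subset\mathbb{T}$ open, $c_\mu(U)=\inf\{\|u\|_\mu^2: u\in\mathcal{D}^h(\mu),\ u\ge0,\ u\ge1\text{ a.e. on }U\}$; for any $F\subset\mathbb{T}$, $c_\mu(F)=\inf\{c_\mu(U):U\text{ open},\ F\subset U\}$. The modulus of continuity of $\mu$ is $\rho_\mu(t)=\sup\{\mu(\zeta e^{-it},\zeta e^{it}):\zeta\in\mathbb{T}\}$, where $(\zeta e^{-it},\zeta e^{it})=\{\zeta e^{i\theta}:|\theta|<t\}$. $N_E(t)=2\sum_j\mathbf{1}_{\{|I_j|>2t\}}$, where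 $(I_j)$ are the connected components of $\mathbb{T}\setminus E$ and $|I_j|$ their arc lengths. *)

theory Defs
  imports "HOL-Analysis.Analysis" "HOL-Library.Complex_Order"
begin

abbreviation circle :: "complex set" where
  "circle \<equiv> sphere 0 1"

text \<open>The normalized Lebesgue measure \<open>dt/2\<pi>\<close>, on the Borel sets of the circle.\<close>

definition circle_measure :: "complex measure" where
  "circle_measure =
     distr (uniform_measure lborel {-pi..<pi}) (restrict_space borel circle) cis"

definition L2_circle :: "(complex \<Rightarrow> complex) set" where
  "L2_circle = {f \<in> borel_measurable circle_measure.
     (\<integral>\<^sup>+ \<zeta>. ennreal ((cmod (f \<zeta>))\<^sup>2) \<partial>circle_measure) < \<infinity>}"

definition poisson_integral :: "(complex \<Rightarrow> complex) \<Rightarrow> complex \<Rightarrow> complex" where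
  "poisson_integral f z =
     (\<integral>\<zeta>. complex_of_real ((1 - (cmod z)\<^sup>2) / (cmod (\<zeta> - z))\<^sup>2) * f \<zeta> \<partial>circle_measure)"

definition stolz_region :: "real \<Rightarrow> complex \<Rightarrow> complex set" where
  "stolz_region M \<xi> = {z. cmod z < 1 \<and> cmod (z - \<xi>) < M * (1 - cmod z)}"

definition has_nontangential_limit ::
    "(complex \<Rightarrow> complex) \<Rightarrow> complex \<Rightarrow> complex \<Rightarrow> bool" where
  "has_nontangential_limit u \<xi> L \<longleftrightarrow>
     (\<forall>M>1. (u \<longlongrightarrow> L) (at \<xi> within stolz_region M \<xi>))"

definition boundary_value :: "(complex \<Rightarrow> complex) \<Rightarrow> complex \<Rightarrow> complex" where
  "boundary_value f \<xi> = (THE L. has_nontangential_limit (poisson_integral f) \<xi> L)"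

definition local_dirichlet_integral :: "(complex \<Rightarrow> complex) \<Rightarrow> complex \<Rightarrow> ennreal" where
  "local_dirichlet_integral f \<xi> =
     (if \<exists>L. has_nontangential_limit (poisson_integral f) \<xi> L
      then \<integral>\<^sup>+ \<zeta>. ennreal ((cmod (f \<zeta> - boundary_value f \<xi>))\<^sup>2 / (cmod (\<zeta> - \<xi>))\<^sup>2)
             \<partial>circle_measure
      else \<infinity>)"

definition dirichlet_integral :: "complex measure \<Rightarrow> (complex \<Rightarrow> complex) \<Rightarrow> ennreal" where
  "dirichlet_integral \<mu> f = (\<integral>\<^sup>+ \<xi>. local_dirichlet_integral f \<xi> \<partial>\<mu>)"

definition dirichlet_norm_sq :: "complex measure \<Rightarrow> (complex \<Rightarrow> complex) \<Rightarrow> ennreal" where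
  "dirichlet_norm_sq \<mu> f =
     (\<integral>\<^sup>+ \<zeta>. ennreal ((cmod (f \<zeta>))\<^sup>2) \<partial>circle_measure) + dirichlet_integral \<mu> f"

definition harmonic_dirichlet_space :: "complex measure \<Rightarrow> (complex \<Rightarrow> complex) set" where
  "harmonic_dirichlet_space \<mu> = {f \<in> L2_circle. dirichlet_norm_sq \<mu> f < \<infinity>}"

text \<open>In the order on the complex numbers used here, \<open>0 \<le> u \<zeta>\<close> and \<open>1 \<le> u \<zeta>\<close>
  say in particular that \<open>u \<zeta>\<close> is real.\<close>

definition open_capacity :: "complex measure \<Rightarrow> complex set \<Rightarrow> ennreal" where
  "open_capacity \<mu> U =
     Inf {dirichlet_norm_sq \<mu> u | u. u \<in> harmonic_dirichlet_space \<mu> \<and>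
       (AE \<zeta> in circle_measure. 0 \<le> u \<zeta>) \<and>
       (AE \<zeta> in circle_measure. \<zeta> \<in> U \<longrightarrow> 1 \<le> u \<zeta>)}"

definition capacity :: "complex measure \<Rightarrow> complex set \<Rightarrow> ennreal" where
  "capacity \<mu> F = Inf {open_capacity \<mu> U | U. openin (top_of_set circle) U \<and> F \<subseteq> U}"

definition modulus_of_continuity :: "complex measure \<Rightarrow> real \<Rightarrow> ennreal" where
  "modulus_of_continuity \<mu> t =
     (SUP \<zeta>\<in>circle. emeasure \<mu> {\<zeta> * cis \<theta> | \<theta>. \<bar>\<theta>\<bar> < t})"

definition arc_length :: "complex set \<Rightarrow> real" where
  "arc_length I = 2 * pi * measure circle_measure I"

definition gap_counting :: "complex set \<Rightarrow> real \<Rightarrow> ennreal" where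
  "gap_counting E t =
     2 * (\<Sum>\<^sub>\<infinity>I\<in>components (circle - E). indicator {J. arc_length J > 2 * t} I)"

end

theory Submission
  imports Defs "HOL-Complex_Analysis.Cauchy_Integral_Formula"
begin

text \<open>Put \<open>t\<^sub>k = 4\<^sup>-\<^sup>k\<close> and test the capacity with functions \<open>u = \<Sum> c\<^sub>k \<psi>\<^sub>k\<close>, where \<open>\<psi>\<^sub>k\<close> is a
  Lipschitz function of the distance to \<open>E\<close>, equal to 1 at distance at most \<open>t\<^sub>k / 2\<close> and to 0 beyond \<open>t\<^sub>k\<close>,
  and \<open>\<Sum> c\<^sub>k = 1\<close>. Such a \<open>u\<close> is Lipschitz, hence it is its own non-tangential boundary function.
  A Schur test with the weights \<open>(|\<zeta> - \<xi>| / t\<^sub>k)\<close> to the power \<open>1/2\<close> makes the pieces almost orthogonal: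
  the Dirichlet integral of \<open>u\<close> is at most a constant times \<open>\<Sum> c\<^sub>k\<^sup>2 m(t\<^sub>k) \<sigma>(E\<^sub>k) / t\<^sub>k\<^sup>2\<close>, where \<open>m(t)\<close> is the
  largest \<open>\<mu>\<close>-measure of a ball of radius \<open>t\<close> and \<open>\<sigma>(E\<^sub>k)\<close> is the length of the \<open>3t\<^sub>k\<close>-neighbourhood of \<open>E\<close>.
  Since \<open>m(t)/t\<close> is essentially decreasing and \<open>\<sigma>(E\<^sub>k)\<close> is controlled by \<open>\<integral> N\<^sub>E\<close> over \<open>(0, t\<^sub>k)\<close>, this is at most a
  constant times \<open>\<Sum> c\<^sub>k\<^sup>2 W(t\<^sub>k) / t\<^sub>k\<close> with \<open>W(t)\<close> the inner integral of the hypothesis. The hypothesis says that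
  \<open>\<Sum> t\<^sub>k / W(t\<^sub>k)\<close> diverges, so weights \<open>c\<^sub>k\<close> proportional to \<open>t\<^sub>k / W(t\<^sub>k)\<close> make the sum arbitrarily small.\<close>

section \<open>Arc length on the circle\<close>

lemma space_circle_measure [simp]: "space circle_measure = circle"
  by (simp add: circle_measure_def space_restrict_space)

lemma sets_circle_measure: "sets circle_measure = sets (restrict_space borel circle)"
  by (simp add: circle_measure_def)

lemma borel_measurable_cis [measurable]: "cis \<in> borel_measurable borel"
  by (intro borel_measurable_continuous_onI continuous_intros)

lemma cis_measurable [measurable]:
  "cis \<in> measurable (uniform_measure lborel {-pi..<pi}) (restrict_space borel circle)"
proof -
  have "cis \<in> measurable borel (restrict_space borel circle)"
    by (intro measurable_restrict_space2) auto
  then show ?thesis by (simp add: measurable_def)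
qed

lemma emeasure_circle_measure:
  assumes "A \<in> sets borel" "A \<subseteq> circle"
  shows "emeasure circle_measure A = emeasure lborel ({-pi..<pi} \<inter> cis -` A) / ennreal (2*pi)"
proof -
  have A: "A \<in> sets (restrict_space borel circle)" using assms
    by (auto simp: sets_restrict_space)
  have "emeasure circle_measure A = emeasure (uniform_measure lborel {-pi..<pi}) (cis -` A)"
    unfolding circle_measure_def using A by (subst emeasure_distr) auto
  also have "\<dots> = emeasure lborel ({-pi..<pi} \<inter> cis -` A) / emeasure lborel {-pi..<pi}"
    using assms(1) by (intro emeasure_uniform_measure)
       (auto intro!: measurable_sets_borel[OF borel_measurable_cis])
  finally show ?thesis by simp
qed

lemma emeasure_circle_measure_circle [simp]: "emeasure circle_measure circle = 1"
proof -
  have "{-pi..<pi} \<inter> cis -` circle = {-pi..<pi}" by auto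
  then show ?thesis by (subst emeasure_circle_measure) (auto simp: divide_ennreal)
qed

lemma finite_measure_circle_measure: "finite_measure circle_measure"
  by (rule finite_measureI) simp

section \<open>Chords against arcs, and the length of chordal balls\<close>

lemma dist_cis: "dist (cis a) (cis b) = 2 * \<bar>sin ((a - b)/2)\<bar>"
proof -
  have *: "cos (a-b) = 1 - 2 * (sin ((a-b)/2))\<^sup>2" using cos_double_sin[of "(a-b)/2"]
    by (simp only: mult_2 field_sum_of_halves)
  have "(dist (cis a) (cis b))\<^sup>2 = (cos a - cos b)\<^sup>2 + (sin a - sin b)\<^sup>2"
    by (simp add: dist_norm cmod_power2)
  also have "\<dots> = 2 - 2 * cos (a - b)"
    using sin_cos_squared_add[of a] sin_cos_squared_add[of b]
    by (simp add: cos_diff power2_eq_square algebra_simps)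
  also have "\<dots> = (2 * \<bar>sin ((a - b)/2)\<bar>)\<^sup>2" by (simp add: * power_mult_distrib)
  finally show ?thesis by (rule power2_eq_imp_eq) auto
qed

lemma dist_cis_le: "dist (cis a) (cis b) \<le> \<bar>a - b\<bar>"
  using abs_sin_le_one abs_sin_x_le_abs_x[of "(a-b)/2"] by (simp add: dist_cis)

text \<open>Jordan's inequality: \<open>sin\<close> is concave on \<open>{0..pi}\<close>, so on
  \<open>[0, pi/2]\<close> it lies above the chord joining its values at the end points.\<close>

lemma jordan_sin:
  assumes "0 \<le> x" "x \<le> pi/2" shows "2 * x / pi \<le> sin x"
proof (cases "x = 0")
  case False
  have "concave_on {0..pi} sin"
    by (rule f''_le0_imp_concave[where f' = cos and f'' = "\<lambda>x. - sin x"])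
       (auto intro!: derivative_eq_intros sin_ge_zero)
  from concave_onD[OF this, of "2*x/pi" 0 "pi/2"] assms show ?thesis
    by (simp add: field_simps)
qed auto

lemma dist_cis_ge:
  assumes "\<bar>a - b\<bar> \<le> pi" shows "2 / pi * \<bar>a - b\<bar> \<le> dist (cis a) (cis b)"
proof -
  have "2 * (\<bar>a - b\<bar>/2) / pi \<le> sin (\<bar>a - b\<bar>/2)" using assms by (intro jordan_sin) auto
  also have "\<dots> \<le> \<bar>sin ((a - b)/2)\<bar>" using sin_minus[of "(a-b)/2"] by (cases "a \<ge> b") (auto simp: minus_divide_left)
  finally show ?thesis by (simp add: dist_cis)
qed

lemma circle_eq_cis:
  assumes "\<zeta> \<in> circle" obtains \<alpha> where "-pi \<le> \<alpha>" "\<alpha> < pi" "\<zeta> = cis \<alpha>"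
proof -
  have n: "norm \<zeta> = 1" using assms by simp
  define a where "a = Arg \<zeta>"
  have a: "cis a = \<zeta>" "-pi < a" "a \<le> pi" using cis_Arg[of \<zeta>] n Arg_bounded[of \<zeta>]
    by (fastforce simp: a_def sgn_eq)+
  show ?thesis
  \<comment> \<open>\<open>Arg\<close> takes values in \<open>(-pi, pi]\<close>, while
    \<open>circle_measure\<close> is built on \<open>[-pi, pi)\<close>; only the point -1 has to be
    moved.\<close>
  proof (cases "a = pi")
    case True
    then have "\<zeta> = cis (-pi)" using a by (auto simp: complex_eq_iff)
    then show ?thesis using that[of "-pi"] by auto
  next
    case False then show ?thesis using that[of a] a by auto
  qed
qed

text \<open>By Jordan's inequality, the angles of points at chordal distance at most
  \<open>r\<close> lie in a window of half-width \<open>pi*r/2\<close> around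
  \<open>\<alpha>\<close> or one of its translates by \<open>2*pi\<close>. Adding the three windows
  gives \<open>3/2 * r\<close>, rounded up to \<open>2 * r\<close>.\<close>

lemma circle_measure_cball_le:
  assumes \<zeta>: "\<zeta> \<in> circle" and r: "r \<ge> 0"
  shows "emeasure circle_measure (circle \<inter> cball \<zeta> r) \<le> ennreal (2 * r)"
proof -
  obtain \<alpha> where \<alpha>: "-pi \<le> \<alpha>" "\<alpha> < pi" "\<zeta> = cis \<alpha>" using circle_eq_cis \<zeta> by blast
  let ?J = "\<lambda>b. {b - pi*r/2..b + pi*r/2}"
  have "{-pi..<pi} \<inter> cis -` (circle \<inter> cball \<zeta> r) \<subseteq> ?J \<alpha> \<union> ?J (\<alpha> + 2*pi) \<union> ?J (\<alpha> - 2*pi)"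
  proof
    fix \<theta> assume "\<theta> \<in> {-pi..<pi} \<inter> cis -` (circle \<inter> cball \<zeta> r)"
    then have \<theta>: "-pi \<le> \<theta>" "\<theta> < pi" "dist (cis \<alpha>) (cis \<theta>) \<le> r" by (auto simp: \<alpha>)
    have *: "\<bar>\<theta> - b\<bar> \<le> pi*r/2" if "cis b = cis \<alpha>" "\<bar>b - \<theta>\<bar> \<le> pi" for b
      
    proof -
      have "2 / pi * \<bar>b - \<theta>\<bar> \<le> r" using dist_cis_ge[OF that(2)] that(1) \<theta>(3) by simp
      then show ?thesis using pi_gt_zero by (simp add: field_simps abs_minus_commute)
    qed
    have c: "cis (\<alpha> + 2*pi) = cis \<alpha>" "cis (\<alpha> - 2*pi) = cis \<alpha>"
      by (auto simp: complex_eq_iff cos_diff sin_diff)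
    consider "\<bar>\<alpha> - \<theta>\<bar> \<le> pi" | "\<bar>\<alpha> + 2*pi - \<theta>\<bar> \<le> pi" | "\<bar>\<alpha> - 2*pi - \<theta>\<bar> \<le> pi"
      using \<alpha> \<theta> by linarith
    then show "\<theta> \<in> ?J \<alpha> \<union> ?J (\<alpha> + 2*pi) \<union> ?J (\<alpha> - 2*pi)"
    proof cases
      case 1
      from *[OF _ 1] have "\<theta> \<in> ?J \<alpha>" unfolding atLeastAtMost_iff abs_le_iff by simp
      then show ?thesis by blast
    next
      case 2
      from *[OF c(1) 2] have "\<theta> \<in> ?J (\<alpha> + 2*pi)" unfolding atLeastAtMost_iff abs_le_iff by linarith
      then show ?thesis by blast
    next
      case 3
      from *[OF c(2) 3] have "\<theta> \<in> ?J (\<alpha> - 2*pi)" unfolding atLeastAtMost_iff abs_le_iff by linarith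
      then show ?thesis by blast
    qed
  qed
  then have "emeasure lborel ({-pi..<pi} \<inter> cis -` (circle \<inter> cball \<zeta> r))
     \<le> emeasure lborel (?J \<alpha> \<union> ?J (\<alpha> + 2*pi) \<union> ?J (\<alpha> - 2*pi))"
    by (intro emeasure_mono) auto
  also have "\<dots> \<le> emeasure lborel (?J \<alpha> \<union> ?J (\<alpha> + 2*pi)) + emeasure lborel (?J (\<alpha> - 2*pi))"
    by (intro emeasure_subadditive) auto
  also have "\<dots> \<le> emeasure lborel (?J \<alpha>) + emeasure lborel (?J (\<alpha> + 2*pi)) + emeasure lborel (?J (\<alpha> - 2*pi))"
    by (intro add_right_mono emeasure_subadditive) auto
  also have "\<dots> = ennreal (3 * pi * r)" using r by (simp flip: ennreal_plus)
  finally have "emeasure circle_measure (circle \<inter> cball \<zeta> r) \<le> ennreal (3*pi*r) / ennreal (2*pi)"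
    by (subst emeasure_circle_measure) (auto intro!: divide_right_mono_ennreal)
  also have "\<dots> = ennreal (3/2 * r)" using r by (simp add: divide_ennreal)
  also have "\<dots> \<le> ennreal (2 * r)" using r by (intro ennreal_leI) auto
  finally show ?thesis .
qed

lemma circle_measure_ball_ge:
  assumes \<zeta>: "\<zeta> \<in> circle" and s: "0 \<le> s" "s \<le> pi"
  shows "ennreal (s / (2 * pi)) \<le> emeasure circle_measure (circle \<inter> ball \<zeta> s)"
proof -
  obtain \<alpha> where \<alpha>: "-pi \<le> \<alpha>" "\<alpha> < pi" "\<zeta> = cis \<alpha>" using circle_eq_cis \<zeta> by blast
  \<comment> \<open>An arc of length \<open>s\<close> on one side of \<open>\<alpha>\<close> is
    enough. It is taken on the side of the angle 0, so that it does not leave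
    \<open>[-pi, pi)\<close>.\<close>
  obtain J where J: "J \<in> sets borel" "emeasure lborel J = ennreal s"
    and JJ: "\<And>\<theta>. \<theta> \<in> J \<Longrightarrow> \<bar>\<alpha> - \<theta>\<bar> < s \<and> -pi \<le> \<theta> \<and> \<theta> < pi"
  proof (cases "\<alpha> \<le> 0")
    case True then show ?thesis using that[of "{\<alpha><..<\<alpha>+s}"] s \<alpha> by auto
  next
    case False then show ?thesis using that[of "{\<alpha>-s<..<\<alpha>}"] s \<alpha> by auto
  qed
  have "J \<subseteq> {-pi..<pi} \<inter> cis -` (circle \<inter> ball \<zeta> s)"
  proof
    fix \<theta> assume "\<theta> \<in> J"
    from JJ[OF this] dist_cis_le[of \<alpha> \<theta>] show "\<theta> \<in> {-pi..<pi} \<inter> cis -` (circle \<inter> ball \<zeta> s)"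
      by (simp add: \<alpha>)
  qed
  moreover have "{-pi..<pi} \<inter> cis -` (circle \<inter> ball \<zeta> s) \<in> sets lborel"
    by (auto intro!: sets.Int measurable_sets_borel[OF borel_measurable_cis])
  ultimately have "ennreal s \<le> emeasure lborel ({-pi..<pi} \<inter> cis -` (circle \<inter> ball \<zeta> s))"
    using J by (metis emeasure_mono)
  then have "ennreal s / ennreal (2*pi) \<le> emeasure circle_measure (circle \<inter> ball \<zeta> s)"
    by (subst emeasure_circle_measure) (auto intro!: divide_right_mono_ennreal)
  then show ?thesis using s by (simp add: divide_ennreal)
qed

section \<open>Poisson integrals of Lipschitz functions\<close>

definition poisson_kernel :: "complex \<Rightarrow> complex \<Rightarrow> real" where
  "poisson_kernel z \<zeta> = (1 - (cmod z)\<^sup>2) / (cmod (\<zeta> - z))\<^sup>2"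

lemma poisson_kernel_nonneg: "cmod z < 1 \<Longrightarrow> 0 \<le> poisson_kernel z \<zeta>"
  by (simp add: poisson_kernel_def power_le_one)

lemma borel_measurable_poisson_kernel [measurable]: "poisson_kernel z \<in> borel_measurable borel"
  unfolding poisson_kernel_def by measurable

lemma measurable_circle_measureI [measurable (raw)]:
  "f \<in> borel_measurable borel \<Longrightarrow> f \<in> borel_measurable circle_measure"
  unfolding measurable_cong_sets[OF sets_circle_measure refl] by (rule measurable_restrict_space1)

text \<open>On the circle the Poisson kernel is the real part of the Herglotz kernel, here written
  as an analytic function of \<open>\<zeta>\<close>, so that its mean can be computed by Cauchy's
  formula.\<close>

lemma poisson_kernel_eq_Re:
  assumes "cmod z < 1" "cmod \<zeta> = 1"
  shows "poisson_kernel z \<zeta> = Re (2 / (1 - cnj z * \<zeta>) - 1)"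
proof -
  have ne: "1 - cnj z * \<zeta> \<noteq> 0"
  proof
    assume "1 - cnj z * \<zeta> = 0"
    then have "cmod (cnj z * \<zeta>) = 1" by simp
    with assms show False by (simp add: norm_mult)
  qed
  have "cmod (\<zeta> - z) = cmod (cnj \<zeta> * (\<zeta> - z))" using assms by (simp add: norm_mult)
  also have "cnj \<zeta> * (\<zeta> - z) = cnj (1 - cnj z * \<zeta>)"
    using assms complex_norm_square[of \<zeta>] by (simp add: algebra_simps)
  finally have eq: "cmod (\<zeta> - z) = cmod (1 - cnj z * \<zeta>)" by (simp only: complex_mod_cnj)
  have "2 / (1 - cnj z * \<zeta>) - 1 = (1 + cnj z * \<zeta>) / (1 - cnj z * \<zeta>)"
    using ne by (simp add: field_simps)
  also have "\<dots> = (1 + cnj z * \<zeta>) * cnj (1 - cnj z * \<zeta>) / of_real ((cmod (1 - cnj z * \<zeta>))\<^sup>2)"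
    by (subst complex_div_cnj) simp
  finally have "Re (2 / (1 - cnj z * \<zeta>) - 1)
      = Re ((1 + cnj z * \<zeta>) * cnj (1 - cnj z * \<zeta>)) / (cmod (1 - cnj z * \<zeta>))\<^sup>2"
    by (simp only: Re_divide_of_real)
  also have "Re ((1 + cnj z * \<zeta>) * cnj (1 - cnj z * \<zeta>)) = 1 - (cmod (cnj z * \<zeta>))\<^sup>2"
    by (simp only: cmod_power2) (simp add: algebra_simps power2_eq_square)
  finally show ?thesis using assms eq by (simp add: poisson_kernel_def norm_mult)
qed

text \<open>Mean value property at the origin, where the Herglotz kernel equals 1. It is applied
  with \<open>1 + cnj z * w\<close> in place of \<open>1 - cnj z * w\<close>: the circle path runs
  over \<open>[0, 2*pi]\<close>, and the shift by \<open>pi\<close> that leads to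
  \<open>[-pi, pi]\<close> changes the sign of \<open>cis\<close>.\<close>

lemma has_integral_poisson_kernel:
  assumes z: "cmod z < 1"
  shows "((\<lambda>\<theta>. poisson_kernel z (cis \<theta>)) has_integral 2 * pi) {-pi..pi}"
proof -
  have ne: "1 + cnj z * w \<noteq> 0" if "cmod w \<le> 1" for w
  proof
    assume "1 + cnj z * w = 0"
    then have "cnj z * w = -1" by (simp add: add_eq_0_iff)
    then have "cmod z * cmod w = 1" by (metis complex_mod_cnj norm_minus_cancel norm_mult norm_one)
    with that z show False
      by (metis mult_left_le_one_le mult.commute norm_ge_zero not_le)
  qed
  have "(\<lambda>w. 2 / (1 + cnj z * w) - 1) holomorphic_on cball 0 1"
    using ne by (intro holomorphic_intros) auto
  from Cauchy_integral_circlepath_simple[OF this, of 0]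
  have "((\<lambda>w. (2 / (1 + cnj z * w) - 1) / w) has_contour_integral 2 * of_real pi * \<i>)
     (part_circlepath 0 1 0 (2*pi))" by (simp add: circlepath_def)
  then have "((\<lambda>t. (2 / (1 + cnj z * cis t) - 1) / cis t * \<i> * cis t) has_integral 2 * of_real pi * \<i>) {0..2*pi}"
    by (subst (asm) has_contour_integral_part_circlepath_iff) auto
  from has_integral_mult_right[OF this, of "-\<i>"]
  have "((\<lambda>t. 2 / (1 + cnj z * cis t) - 1) has_integral 2 * of_real pi) {0..2*pi}"
    by (simp add: mult_ac)
  from has_integral_Re[OF this]
  have "((\<lambda>t. Re (2 / (1 + cnj z * cis t) - 1)) has_integral 2 * pi) {0..2*pi}" by simp
  from has_integral_affinity[OF this[folded cbox_interval], of 1 pi]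
  have "((\<lambda>t. Re (2 / (1 + cnj z * cis (t + pi)) - 1)) has_integral 2 * pi) ((\<lambda>x. x - pi) ` {0..2*pi})"
    by simp
  moreover have "(\<lambda>x. x - pi) ` {0..2*pi} = {-pi..pi}"
    using image_add_atLeastAtMost[of "-pi" 0 "2*pi"] by simp
  moreover have "Re (2 / (1 + cnj z * cis (t + pi)) - 1) = poisson_kernel z (cis t)" for t
  proof -
    have "cis (t + pi) = - cis t" by (simp add: complex_eq_iff)
    then show ?thesis using z by (simp add: poisson_kernel_eq_Re)
  qed
  ultimately show ?thesis by simp
qed

lemma nn_integral_poisson_kernel:
  assumes z: "cmod z < 1"
  shows "(\<integral>\<^sup>+\<zeta>. ennreal (poisson_kernel z \<zeta>) \<partial>circle_measure) = 1"
proof -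
  have "(\<integral>\<^sup>+\<zeta>. ennreal (poisson_kernel z \<zeta>) \<partial>circle_measure)
      = (\<integral>\<^sup>+\<theta>. ennreal (poisson_kernel z (cis \<theta>)) \<partial>uniform_measure lborel {-pi..<pi})"
    unfolding circle_measure_def
    by (rule nn_integral_distr) (auto intro!: measurable_restrict_space1)
  also have "\<dots> = (\<integral>\<^sup>+\<theta>. ennreal (poisson_kernel z (cis \<theta>)) * indicator {-pi..<pi} \<theta> \<partial>lborel)
       / emeasure lborel {-pi..<pi}"
    by (rule nn_integral_uniform_measure) auto
  also have "(\<integral>\<^sup>+\<theta>. ennreal (poisson_kernel z (cis \<theta>)) * indicator {-pi..<pi} \<theta> \<partial>lborel)
     = (\<integral>\<^sup>+\<theta>. ennreal (indicator {-pi..pi} \<theta> * poisson_kernel z (cis \<theta>)) \<partial>lborel)"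
    using AE_lborel_singleton[of pi] 
    by (intro nn_integral_cong_AE) (auto elim!: eventually_mono simp: indicator_def)
  also have "\<dots> = ennreal (2 * pi)"
    by (rule nn_integral_has_integral_lebesgue[OF _ has_integral_poisson_kernel[OF z]])
       (simp add: poisson_kernel_nonneg z)
  finally show ?thesis by (simp add: divide_ennreal)
qed

lemma has_bochner_integral_poisson_kernel:
  assumes z: "cmod z < 1"
  shows "has_bochner_integral circle_measure (poisson_kernel z) 1"
  by (rule has_bochner_integral_nn_integral)
     (simp_all add: poisson_kernel_nonneg z nn_integral_poisson_kernel)

lemma circle_measure_integrableI:
  fixes f :: "complex \<Rightarrow> 'a :: {banach, second_countable_topology}"
  assumes "continuous_on circle f" shows "integrable circle_measure f"
proof -
  interpret finite_measure circle_measure by (rule finite_measure_circle_measure)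
  have "compact (f ` circle)" using assms by (intro compact_continuous_image) auto
  then obtain B where B: "\<forall>x\<in>circle. norm (f x) \<le> B"
    by (auto dest!: compact_imp_bounded simp: bounded_iff)
  have "f \<in> borel_measurable circle_measure"
    using borel_measurable_continuous_on_restrict[OF assms]
    unfolding measurable_cong_sets[OF sets_circle_measure refl] .
  then show ?thesis
    by (rule integrable_const_bound[rotated]) (use B in \<open>auto intro!: AE_I2\<close>)
qed

text \<open>The kernel P has mass one, so the difference is the P-average of
  \<open>u \<zeta> - u \<xi>\<close>, which is at most \<open>L\<close> times
  \<open>dist \<zeta> z + dist z \<xi>\<close>. The average of \<open>dist \<zeta> z\<close> is at
  most \<open>a = sqrt (1 - (cmod z)\<^sup>2)\<close>.\<close>

lemma poisson_integral_lipschitz: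
  assumes lip: "L-lipschitz_on circle u" and z: "cmod z < 1" and \<xi>: "\<xi> \<in> circle"
  shows "dist (poisson_integral u z) (u \<xi>) \<le> L * (sqrt (1 - (cmod z)\<^sup>2) + dist z \<xi>)"
proof -
  interpret finite_measure circle_measure by (rule finite_measure_circle_measure)
  let ?P = "poisson_kernel z"
  have L0: "L \<ge> 0" using lip by (rule lipschitz_on_nonneg)
  have contu: "continuous_on circle u" using lip by (rule lipschitz_on_continuous_on)
  have contP: "continuous_on circle ?P"
    unfolding poisson_kernel_def using z by (auto intro!: continuous_intros)
  define a where "a = sqrt (1 - (cmod z)\<^sup>2)"
  have a0: "a > 0" and a2: "a\<^sup>2 = 1 - (cmod z)\<^sup>2"
    using z by (auto simp: a_def abs_square_less_1 power_le_one less_imp_le)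
  have P1: "integrable circle_measure ?P" "integral\<^sup>L circle_measure ?P = 1"
    using has_bochner_integral_poisson_kernel[OF z] by (auto simp: has_bochner_integral_iff)
  have one: "integral\<^sup>L circle_measure (\<lambda>_. 1::real) = 1"
    by (simp add: measure_def)
  have "poisson_integral u z - u \<xi> = (\<integral>\<zeta>. ?P \<zeta> *\<^sub>R u \<zeta> \<partial>circle_measure) - (\<integral>\<zeta>. ?P \<zeta> *\<^sub>R u \<xi> \<partial>circle_measure)"
    using P1 by (simp add: poisson_integral_def scaleR_conv_of_real flip: poisson_kernel_def)
  also have "\<dots> = (\<integral>\<zeta>. ?P \<zeta> *\<^sub>R (u \<zeta> - u \<xi>) \<partial>circle_measure)"
    by (subst Bochner_Integration.integral_diff[symmetric])
       (auto intro!: circle_measure_integrableI continuous_intros contu contP simp: scaleR_diff_right)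
  finally have "dist (poisson_integral u z) (u \<xi>) = norm (\<integral>\<zeta>. ?P \<zeta> *\<^sub>R (u \<zeta> - u \<xi>) \<partial>circle_measure)"
    by (simp add: dist_norm)
  also have "\<dots> \<le> (\<integral>\<zeta>. norm (?P \<zeta> *\<^sub>R (u \<zeta> - u \<xi>)) \<partial>circle_measure)" by (rule integral_norm_bound)
  also have "\<dots> \<le> (\<integral>\<zeta>. L * ((a/2 + dist z \<xi>) * ?P \<zeta> + a / 2) \<partial>circle_measure)"
  proof (rule integral_mono)
    show "norm (?P \<zeta> *\<^sub>R (u \<zeta> - u \<xi>)) \<le> L * ((a/2 + dist z \<xi>) * ?P \<zeta> + a / 2)"
      if "\<zeta> \<in> space circle_measure" for \<zeta>
    proof -
      have \<zeta>: "\<zeta> \<in> circle" using that by simp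
      have ne: "\<zeta> \<noteq> z" using z \<zeta> by auto
      have P0: "?P \<zeta> \<ge> 0" using z by (rule poisson_kernel_nonneg)
      have P2: "?P \<zeta> * (dist \<zeta> z)\<^sup>2 = a\<^sup>2" using ne by (simp add: poisson_kernel_def dist_norm a2)
      \<comment> \<open>The inequality of arithmetic and geometric means, balanced by
        \<open>P2\<close>: it bounds the kernel times \<open>dist \<zeta> z\<close> by an affine
        function of the kernel, whose integral is known exactly.\<close>
      have "0 \<le> (a - dist \<zeta> z)\<^sup>2" by simp
      then have "2 * a * dist \<zeta> z \<le> a\<^sup>2 + (dist \<zeta> z)\<^sup>2" by (simp add: power2_diff)
      then have "?P \<zeta> * (2 * a * dist \<zeta> z) \<le> ?P \<zeta> * (a\<^sup>2 + (dist \<zeta> z)\<^sup>2)" using P0 by (rule mult_left_mono)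
      also have "\<dots> = ?P \<zeta> * a\<^sup>2 + a\<^sup>2" by (simp add: algebra_simps P2)
      finally have "a * (2 * (?P \<zeta> * dist \<zeta> z)) \<le> a * (a * ?P \<zeta> + a)"
        by (simp add: algebra_simps power2_eq_square)
      then have *: "?P \<zeta> * dist \<zeta> z \<le> a/2 * ?P \<zeta> + a/2" using a0 by simp
      have "norm (?P \<zeta> *\<^sub>R (u \<zeta> - u \<xi>)) = ?P \<zeta> * dist (u \<zeta>) (u \<xi>)" using P0 by (simp add: dist_norm)
      also have "\<dots> \<le> ?P \<zeta> * (L * dist \<zeta> \<xi>)" using lip \<zeta> \<xi> P0
        by (intro mult_left_mono) (auto dest: lipschitz_onD)
      also have "\<dots> \<le> ?P \<zeta> * (L * (dist \<zeta> z + dist z \<xi>))"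
        using P0 L0 by (intro mult_left_mono dist_triangle) auto
      also have "\<dots> = L * (?P \<zeta> * dist \<zeta> z + dist z \<xi> * ?P \<zeta>)" by (simp add: algebra_simps)
      also have "\<dots> \<le> L * (a/2 * ?P \<zeta> + a/2 + dist z \<xi> * ?P \<zeta>)"
        using * L0 by (intro mult_left_mono add_right_mono) auto
      finally show ?thesis by (simp add: algebra_simps)
    qed
  qed (auto intro!: circle_measure_integrableI continuous_intros contu contP)
  also have "\<dots> = L * ((a/2 + dist z \<xi>) * 1 + a / 2)"
    using P1 one by simp
  finally show ?thesis by (simp add: a_def)
qed

section \<open>Non-tangential limits of Lipschitz functions\<close>

text \<open>The radial points \<open>(1 - d) * \<xi>\<close> belong to the region because
  \<open>M > 1\<close>. This yields the uniqueness of limits that the \<open>THE\<close> in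
  \<open>boundary_value\<close> requires.\<close>

lemma stolz_region_nontrivial:
  assumes "\<xi> \<in> circle" "M > 1"
  shows "at \<xi> within stolz_region M \<xi> \<noteq> bot"
proof -
  have "\<xi> islimpt stolz_region M \<xi>"
  proof (rule islimptI)
    fix T assume "\<xi> \<in> T" "open T"
    then obtain e where e: "e > 0" "ball \<xi> e \<subseteq> T" using openE by blast
    define d where "d = min (e/2) (1/2)"
    have d: "0 < d" "d < e" "d < 1" using e by (auto simp: d_def)
    define z where "z = of_real (1 - d) * \<xi>"
    have n: "cmod z = 1 - d" using assms d by (simp add: z_def norm_mult del: of_real_diff)
    have "z - \<xi> = - of_real d * \<xi>" by (simp add: z_def algebra_simps)
    then have dz: "cmod (z - \<xi>) = d" using assms d by (simp add: norm_mult)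
    have "z \<in> stolz_region M \<xi>" using n dz assms d by (simp add: stolz_region_def)
    moreover have "z \<in> T" using e dz d by (auto simp: dist_norm norm_minus_commute intro!: subsetD[OF e(2)])
    moreover have "z \<noteq> \<xi>" using dz d by auto
    ultimately show "\<exists>y\<in>stolz_region M \<xi>. y \<in> T \<and> y \<noteq> \<xi>" by blast
  qed
  then show ?thesis by (simp add: trivial_limit_within)
qed

text \<open>The bound of \<open>poisson_integral_lipschitz\<close> tends to 0 as \<open>z\<close>
  approaches \<open>\<xi>\<close> in any manner inside the disc, hence in every Stolz
  region.\<close>

lemma has_nontangential_limit_lipschitz:
  assumes lip: "L-lipschitz_on circle u" and \<xi>: "\<xi> \<in> circle"
  shows "has_nontangential_limit (poisson_integral u) \<xi> (u \<xi>)"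
  unfolding has_nontangential_limit_def
proof (intro allI impI)
  fix M :: real assume "M > 1"
  have "((\<lambda>z. L * (sqrt (1 - (cmod z)\<^sup>2) + dist z \<xi>)) \<longlongrightarrow> L * (sqrt (1 - (cmod \<xi>)\<^sup>2) + dist \<xi> \<xi>))
      (at \<xi> within stolz_region M \<xi>)" by (intro tendsto_intros)
  then have "((\<lambda>z. L * (sqrt (1 - (cmod z)\<^sup>2) + dist z \<xi>)) \<longlongrightarrow> 0) (at \<xi> within stolz_region M \<xi>)"
    using \<xi> by simp
  moreover have "\<forall>\<^sub>F z in at \<xi> within stolz_region M \<xi>.
      dist (poisson_integral u z) (u \<xi>) \<le> L * (sqrt (1 - (cmod z)\<^sup>2) + dist z \<xi>)"
    unfolding eventually_at_filter using poisson_integral_lipschitz[OF lip _ \<xi>]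
    by (intro always_eventually) (simp add: stolz_region_def)
  ultimately have "((\<lambda>z. dist (poisson_integral u z) (u \<xi>)) \<longlongrightarrow> 0) (at \<xi> within stolz_region M \<xi>)"
    by (elim Lim_null_comparison[rotated]) simp
  then show "(poisson_integral u \<longlongrightarrow> u \<xi>) (at \<xi> within stolz_region M \<xi>)"
    by (rule tendsto_dist_iff[THEN iffD2])
qed

lemma boundary_value_lipschitz:
  assumes lip: "L-lipschitz_on circle u" and \<xi>: "\<xi> \<in> circle"
  shows "boundary_value u \<xi> = u \<xi>"
  unfolding boundary_value_def
proof (rule the_equality)
  fix l assume "has_nontangential_limit (poisson_integral u) \<xi> l"
  then have "(poisson_integral u \<longlongrightarrow> l) (at \<xi> within stolz_region 2 \<xi>)"
    "(poisson_integral u \<longlongrightarrow> u \<xi>) (at \<xi> within stolz_region 2 \<xi>)"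
    using has_nontangential_limit_lipschitz[OF assms] by (auto simp: has_nontangential_limit_def)
  then show "l = u \<xi>" by (rule tendsto_unique[OF stolz_region_nontrivial[OF \<xi>], rotated]) simp
qed (rule has_nontangential_limit_lipschitz[OF assms])

lemma local_dirichlet_integral_lipschitz:
  assumes "L-lipschitz_on circle u" "\<xi> \<in> circle"
  shows "local_dirichlet_integral u \<xi>
     = (\<integral>\<^sup>+ \<zeta>. ennreal ((dist (u \<zeta>) (u \<xi>))\<^sup>2 / (dist \<zeta> \<xi>)\<^sup>2) \<partial>circle_measure)"
proof -
  have "\<exists>L. has_nontangential_limit (poisson_integral u) \<xi> L"
    using has_nontangential_limit_lipschitz[OF assms] by blast
  then show ?thesis
    by (simp only: local_dirichlet_integral_def if_True boundary_value_lipschitz[OF assms] dist_norm)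
qed

section \<open>Fubini estimates for measures on the circle\<close>

lemma ennreal_le_suminf:
  fixes f :: "nat \<Rightarrow> ennreal"
  shows "f j \<le> (\<Sum>i. f i)"
  using sum_le_suminf[OF summableI, of "{j}" f] by simp

text \<open>Both \<open>\<mu>\<close> and arc length are instances, so that one version of the
  kernel estimates serves for integration in either variable.\<close>

locale finite_circle_measure = finite_measure M for M :: "complex measure" +
  assumes sets_M: "sets M = sets (restrict_space borel circle)"

lemma finite_circle_measure_circle_measure: "finite_circle_measure circle_measure"
  by (intro finite_circle_measure.intro finite_circle_measure_axioms.intro
      finite_measure_circle_measure sets_circle_measure)

context finite_circle_measure
begin

lemma space_M: "space M = circle"
  using sets_eq_imp_space_eq[OF sets_M] by (simp add: space_restrict_space)

lemma borel_measurable_M: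
  "f \<in> borel_measurable borel \<Longrightarrow> f \<in> borel_measurable M"
  unfolding measurable_cong_sets[OF sets_M refl] by (rule measurable_restrict_space1)

lemma sets_M_I: "S \<in> sets borel \<Longrightarrow> circle \<inter> S \<in> sets M"
  unfolding sets_M sets_restrict_space by blast

lemma borel_measurable_pair_M:
  fixes f :: "complex \<times> complex \<Rightarrow> ennreal"
  assumes "f \<in> borel_measurable (borel \<Otimes>\<^sub>M borel)"
  shows "f \<in> borel_measurable (M \<Otimes>\<^sub>M circle_measure)"
proof -
  have "(\<lambda>x. x) \<in> borel_measurable M" "(\<lambda>x. x) \<in> borel_measurable circle_measure"
    by (auto intro: borel_measurable_M measurable_circle_measureI)
  then have "(\<lambda>p. (fst p, snd p)) \<in> measurable (M \<Otimes>\<^sub>M circle_measure) (borel \<Otimes>\<^sub>M borel)"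
    by (intro measurable_Pair) (auto intro: measurable_compose[OF measurable_fst] measurable_compose[OF measurable_snd])
  from measurable_compose[OF this assms] show ?thesis by simp
qed

lemma Fubini_circle:
  fixes f :: "complex \<Rightarrow> complex \<Rightarrow> ennreal"
  assumes "case_prod f \<in> borel_measurable (borel \<Otimes>\<^sub>M borel)"
  shows "(\<integral>\<^sup>+\<xi>. \<integral>\<^sup>+\<zeta>. f \<xi> \<zeta> \<partial>circle_measure \<partial>M) = (\<integral>\<^sup>+\<zeta>. \<integral>\<^sup>+\<xi>. f \<xi> \<zeta> \<partial>M \<partial>circle_measure)"
proof -
  interpret S: finite_measure circle_measure by (rule finite_measure_circle_measure)
  interpret pair_sigma_finite M circle_measure ..
  show ?thesis using Fubini'[OF borel_measurable_pair_M[OF assms]] by simp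
qed

text \<open>The chordal counterpart of \<open>modulus_of_continuity\<close>; chords fit better with
  \<open>infdist\<close> and with the kernel of the Dirichlet integral.\<close>

definition ball_modulus :: "real \<Rightarrow> ennreal" where
  "ball_modulus t = (SUP \<zeta>\<in>circle. emeasure M (circle \<inter> ball \<zeta> t))"

lemma emeasure_ball_le_modulus: "\<zeta> \<in> circle \<Longrightarrow> emeasure M (circle \<inter> ball \<zeta> t) \<le> ball_modulus t"
  unfolding ball_modulus_def by (rule SUP_upper)

text \<open>Both sides estimate the product measure of the pairs \<open>(\<xi>, \<zeta>)\<close> with \<open>\<xi> \<in> A\<close> and \<open>|\<xi> - \<zeta>| < s\<close>.
  This double counting replaces all covering arguments.\<close>

lemma emeasure_neighbourhood:
  assumes A: "A \<in> sets M" and B: "B \<in> sets borel" and s: "0 \<le> s" "s \<le> pi"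
    and AB: "\<And>\<xi>. \<xi> \<in> A \<Longrightarrow> circle \<inter> ball \<xi> s \<subseteq> B"
  shows "ennreal (s / (2 * pi)) * emeasure M A \<le> ball_modulus s * emeasure circle_measure (circle \<inter> B)"
proof -
  interpret \<sigma>: finite_circle_measure circle_measure by (rule finite_circle_measure_circle_measure)
  let ?f = "\<lambda>\<xi> \<zeta>. indicator B \<zeta> * (if dist \<xi> \<zeta> < s then 1 else 0) :: ennreal"
  have [measurable]: "B \<in> sets borel" by fact
  have "ennreal (s / (2 * pi)) * emeasure M A = (\<integral>\<^sup>+\<xi>. ennreal (s / (2*pi)) * indicator A \<xi> \<partial>M)"
    by (rule nn_integral_cmult_indicator[symmetric, OF A])
  also have "\<dots> \<le> (\<integral>\<^sup>+\<xi>. \<integral>\<^sup>+\<zeta>. ?f \<xi> \<zeta> \<partial>circle_measure \<partial>M)"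
  proof (rule nn_integral_mono)
    fix \<xi> assume "\<xi> \<in> space M"
    then have \<xi>: "\<xi> \<in> circle" by (simp add: space_M)
    show "ennreal (s / (2*pi)) * indicator A \<xi> \<le> (\<integral>\<^sup>+\<zeta>. ?f \<xi> \<zeta> \<partial>circle_measure)"
    proof (cases "\<xi> \<in> A")
      case True
      have "ennreal (s / (2*pi)) \<le> emeasure circle_measure (circle \<inter> ball \<xi> s)"
        using \<xi> s by (rule circle_measure_ball_ge)
      also have "\<dots> = (\<integral>\<^sup>+\<zeta>. indicator (circle \<inter> ball \<xi> s) \<zeta> \<partial>circle_measure)"
        by (simp add: \<sigma>.sets_M_I)
      also have "\<dots> \<le> (\<integral>\<^sup>+\<zeta>. ?f \<xi> \<zeta> \<partial>circle_measure)"
        using AB[OF True] by (intro nn_integral_mono) (auto simp: indicator_def)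
      finally show ?thesis using True by simp
    qed simp
  qed
  also have "\<dots> = (\<integral>\<^sup>+\<zeta>. \<integral>\<^sup>+\<xi>. ?f \<xi> \<zeta> \<partial>M \<partial>circle_measure)"
    by (rule Fubini_circle) measurable
  also have "\<dots> \<le> (\<integral>\<^sup>+\<zeta>. ball_modulus s * indicator (circle \<inter> B) \<zeta> \<partial>circle_measure)"
  proof (rule nn_integral_mono)
    fix \<zeta> assume "\<zeta> \<in> space circle_measure"
    then have \<zeta>: "\<zeta> \<in> circle" by simp
    have "(\<integral>\<^sup>+\<xi>. ?f \<xi> \<zeta> \<partial>M) \<le> (\<integral>\<^sup>+\<xi>. indicator B \<zeta> * indicator (circle \<inter> ball \<zeta> s) \<xi> \<partial>M)"
      by (intro nn_integral_mono) (auto simp: indicator_def space_M dist_commute)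
    also have "\<dots> = indicator B \<zeta> * emeasure M (circle \<inter> ball \<zeta> s)"
      by (subst nn_integral_cmult_indicator) (auto intro!: sets_M_I)
    also have "\<dots> \<le> ball_modulus s * indicator (circle \<inter> B) \<zeta>"
      using \<zeta> emeasure_ball_le_modulus[of \<zeta> s] by (auto simp: indicator_def)
    finally show "(\<integral>\<^sup>+\<xi>. ?f \<xi> \<zeta> \<partial>M) \<le> ball_modulus s * indicator (circle \<inter> B) \<zeta>" .
  qed
  also have "\<dots> = ball_modulus s * emeasure circle_measure (circle \<inter> B)"
    by (rule nn_integral_cmult_indicator) (auto intro!: \<sigma>.sets_M_I)
  finally show ?thesis .
qed

text \<open>Double counting on a ball of radius \<open>t\<close>, whose
  \<open>s\<close>-neighbourhood has length at most \<open>4 * t\<close>. With \<open>m\<close> for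
  \<open>ball_modulus\<close>, this says that \<open>m(t)/t\<close> is decreasing up to a
  constant.\<close>

lemma emeasure_cball_le:
  assumes s: "0 < s" "s \<le> t" "s \<le> pi" and \<zeta>: "\<zeta> \<in> circle"
  shows "emeasure M (circle \<inter> cball \<zeta> t) \<le> ball_modulus s * ennreal (8 * pi * t / s)"
proof -
  have "ennreal (s / (2 * pi)) * emeasure M (circle \<inter> cball \<zeta> t)
      \<le> ball_modulus s * emeasure circle_measure (circle \<inter> cball \<zeta> (t + s))"
  proof (rule emeasure_neighbourhood)
    fix \<xi> assume "\<xi> \<in> circle \<inter> cball \<zeta> t"
    then show "circle \<inter> ball \<xi> s \<subseteq> cball \<zeta> (t + s)"
      using dist_triangle[of \<zeta> _ \<xi>] by (force intro: order_trans)
  qed (use s in \<open>auto intro!: sets_M_I\<close>)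
  also have "\<dots> \<le> ball_modulus s * ennreal (2 * (t + s))"
    using \<zeta> s by (intro mult_left_mono circle_measure_cball_le) auto
  also have "\<dots> \<le> ball_modulus s * ennreal (4 * t)"
    using s by (intro mult_left_mono ennreal_leI) auto
  finally have le: "ennreal (s / (2 * pi)) * emeasure M (circle \<inter> cball \<zeta> t)
     \<le> ball_modulus s * ennreal (4 * t)" .
  have "emeasure M (circle \<inter> cball \<zeta> t)
      = ennreal (2 * pi / s) * ennreal (s / (2 * pi)) * emeasure M (circle \<inter> cball \<zeta> t)"
    using s by (simp flip: ennreal_mult'')
  also have "\<dots> \<le> ennreal (2 * pi / s) * (ball_modulus s * ennreal (4 * t))"
    unfolding mult.assoc by (rule mult_left_mono[OF le]) simp
  also have "\<dots> = ball_modulus s * (ennreal (2 * pi / s) * ennreal (4 * t))"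
    by (rule mult.left_commute)
  also have "ennreal (2 * pi / s) * ennreal (4 * t) = ennreal (8 * pi * t / s)"
    using s by (subst ennreal_mult[symmetric]) (auto simp: mult_ac)
  finally show ?thesis .
qed

text \<open>On the shell \<open>4^j * t < dist \<le> 4^(j+1) * t\<close> the kernel is at most
  \<open>8^-j\<close> times \<open>1/(t * sqrt t)\<close>, and the shell has mass at most
  \<open>A * 4^(j+1) * t\<close>: a geometric series of ratio 1/2. Scales in powers of 4 keep the
  square roots rational. Growth is assumed from radius \<open>t\<close> on, which is all that holds
  for \<open>\<mu>\<close>.\<close>

lemma kernel_far:
  assumes t: "t > 0" and \<zeta>: "\<zeta> \<in> circle"
    and growth: "\<And>r. r \<ge> t \<Longrightarrow> emeasure M (circle \<inter> cball \<zeta> r) \<le> A * ennreal r"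
  shows "(\<integral>\<^sup>+\<xi>. (if t < dist \<zeta> \<xi> then ennreal (1 / (dist \<zeta> \<xi> * sqrt (dist \<zeta> \<xi>))) else 0) \<partial>M)
      \<le> A * ennreal (8 / sqrt t)"
proof -
  let ?B = "\<lambda>j. circle \<inter> cball \<zeta> (4 ^ Suc j * t)" and ?c = "\<lambda>j. ennreal (1 / (8 ^ j * (t * sqrt t)))"
  have "(\<integral>\<^sup>+\<xi>. (if t < dist \<zeta> \<xi> then ennreal (1 / (dist \<zeta> \<xi> * sqrt (dist \<zeta> \<xi>))) else 0) \<partial>M)
     \<le> (\<integral>\<^sup>+\<xi>. (\<Sum>j. ?c j * indicator (?B j) \<xi>) \<partial>M)"
  proof (rule nn_integral_mono)
    fix \<xi> assume "\<xi> \<in> space M"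
    then have \<xi>: "\<xi> \<in> circle" by (simp add: space_M)
    define r where "r = dist \<zeta> \<xi>"
    have "ennreal (1 / (r * sqrt r)) \<le> (\<Sum>j. ?c j * indicator (?B j) \<xi>)" if r: "t < r"
    proof -
      obtain n where "r / t < 4 ^ n" using real_arch_pow[of 4 "r/t"] by auto
      then have ex: "r \<le> 4 ^ Suc n * t" using t r by (simp add: field_simps)
      define j where "j = (LEAST j. r \<le> 4 ^ Suc j * t)"
      have j1: "r \<le> 4 ^ Suc j * t" unfolding j_def by (rule LeastI[of _ n]) (rule ex)
      have j2: "4 ^ j * t < r"
      proof (cases j)
        case 0 then show ?thesis using r by simp
      next
        case (Suc i)
        then have "\<not> r \<le> 4 ^ Suc i * t" using not_less_Least[of i "\<lambda>j. r \<le> 4 ^ Suc j * t"] by (simp add: j_def)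
        then show ?thesis using Suc by simp
      qed
      have "sqrt (4 ^ j) = 2 ^ j" by (simp add: real_sqrt_power)
      then have "8 ^ j * (t * sqrt t) = (4 ^ j * t) * sqrt (4 ^ j * t)"
        by (simp add: real_sqrt_mult flip: power_mult_distrib)
      also have "\<dots> \<le> r * sqrt r" using j2 t r by (intro mult_mono) auto
      finally have "1 / (r * sqrt r) \<le> 1 / (8 ^ j * (t * sqrt t))" 
        using t less_trans[OF t r] by (intro divide_left_mono) (auto intro!: mult_pos_pos)
      then have "ennreal (1 / (r * sqrt r)) \<le> ?c j * indicator (?B j) \<xi>"
        using j1 \<xi> by (auto simp: r_def intro!: ennreal_leI)
      also have "\<dots> \<le> (\<Sum>j. ?c j * indicator (?B j) \<xi>)"
        by (rule ennreal_le_suminf)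
      finally show ?thesis .
    qed
    then show "(if t < dist \<zeta> \<xi> then ennreal (1 / (dist \<zeta> \<xi> * sqrt (dist \<zeta> \<xi>))) else 0)
        \<le> (\<Sum>j. ?c j * indicator (?B j) \<xi>)" by (simp add: r_def)
  qed
  also have "\<dots> = (\<Sum>j. ?c j * emeasure M (?B j))"
    by (subst nn_integral_suminf) (auto intro!: borel_measurable_times_ennreal borel_measurable_indicator
          sets_M_I suminf_cong nn_integral_cmult_indicator)
  also have "\<dots> \<le> (\<Sum>j. A * ennreal (4 / sqrt t * (1/2) ^ j))"
  proof (rule suminf_le)
    fix j
    have "1 * t \<le> 4 ^ Suc j * t" using t by (intro mult_right_mono one_le_power) auto
    then have "?c j * emeasure M (?B j) \<le> ?c j * (A * ennreal (4 ^ Suc j * t))"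
      by (intro mult_left_mono growth) auto
    also have "\<dots> = A * (?c j * ennreal (4 ^ Suc j * t))" by (simp add: mult_ac)
    also have "?c j * ennreal (4 ^ Suc j * t) = ennreal (1 / (8 ^ j * (t * sqrt t)) * (4 ^ Suc j * t))"
      using t by (subst ennreal_mult) auto
    also have "1 / (8 ^ j * (t * sqrt t)) * (4 ^ Suc j * t) = 4 / sqrt t * (1/2) ^ j"
    proof -
      have "(8::real) ^ j = 4 ^ j * 2 ^ j" by (simp flip: power_mult_distrib)
      then show ?thesis using t by (simp add: field_simps)
    qed
    finally show "?c j * emeasure M (?B j) \<le> A * ennreal (4 / sqrt t * (1/2) ^ j)" .
  qed auto
  also have "\<dots> = A * (\<Sum>j. ennreal (4 / sqrt t * (1/2) ^ j))" by (rule ennreal_suminf_cmult)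
  also have "(\<Sum>j. ennreal (4 / sqrt t * (1/2) ^ j)) = ennreal (4 / sqrt t * 2)"
    using t geometric_sums[of "1/2::real"] by (intro suminf_ennreal_eq sums_mult) auto
  finally show ?thesis by simp
qed

text \<open>The same summation over shells shrinking to the centre, which now takes the growth bound
  at every radius; it is meant for arc length.\<close>

lemma kernel_near:
  assumes t: "t > 0" and \<zeta>: "\<zeta> \<in> circle"
    and growth: "\<And>r. r > 0 \<Longrightarrow> emeasure M (circle \<inter> cball \<zeta> r) \<le> A * ennreal r"
  shows "(\<integral>\<^sup>+\<xi>. (if dist \<zeta> \<xi> \<le> t then ennreal (1 / sqrt (dist \<zeta> \<xi>)) else 0) \<partial>M)
      \<le> A * ennreal (4 * sqrt t)"
proof -
  let ?B = "\<lambda>j. circle \<inter> cball \<zeta> (t / 4 ^ j)" and ?c = "\<lambda>j. ennreal (2 * 2 ^ j / sqrt t)"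
  have "(\<integral>\<^sup>+\<xi>. (if dist \<zeta> \<xi> \<le> t then ennreal (1 / sqrt (dist \<zeta> \<xi>)) else 0) \<partial>M)
     \<le> (\<integral>\<^sup>+\<xi>. (\<Sum>j. ?c j * indicator (?B j) \<xi>) \<partial>M)"
  proof (rule nn_integral_mono)
    fix \<xi> assume "\<xi> \<in> space M"
    then have \<xi>: "\<xi> \<in> circle" by (simp add: space_M)
    define r where "r = dist \<zeta> \<xi>"
    have "ennreal (1 / sqrt r) \<le> (\<Sum>j. ?c j * indicator (?B j) \<xi>)" if r: "r \<le> t" "r > 0"
    proof -
      obtain n where "t / r < 4 ^ n" using real_arch_pow[of 4 "t/r"] by auto
      then have ex: "t / 4 ^ Suc n < r" using t r by (simp add: field_simps)
      define j where "j = (LEAST j. t / 4 ^ Suc j < r)"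
      have j1: "t / 4 ^ Suc j < r" unfolding j_def by (rule LeastI[of _ n]) (rule ex)
      have j2: "r \<le> t / 4 ^ j"
      proof (cases j)
        case 0 then show ?thesis using r by simp
      next
        case (Suc i)
        then have "\<not> t / 4 ^ Suc i < r" using not_less_Least[of i "\<lambda>j. t / 4 ^ Suc j < r"] by (simp add: j_def)
        then show ?thesis using Suc by simp
      qed
      have "sqrt (4 ^ j) = 2 ^ j" by (simp add: real_sqrt_power)
      then have "sqrt t / (2 * 2 ^ j) = sqrt (t / 4 ^ Suc j)"
        by (simp add: real_sqrt_divide real_sqrt_mult)
      also have "\<dots> \<le> sqrt r" using j1 by simp
      finally have "1 / sqrt r \<le> 1 / (sqrt t / (2 * 2 ^ j))" using t r by (intro divide_left_mono) (auto intro!: mult_pos_pos)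
      then have "ennreal (1 / sqrt r) \<le> ?c j * indicator (?B j) \<xi>"
        using j2 \<xi> by (auto simp: r_def intro!: ennreal_leI)
      also have "\<dots> \<le> (\<Sum>j. ?c j * indicator (?B j) \<xi>)"
        by (rule ennreal_le_suminf)
      finally show ?thesis .
    qed
    \<comment> \<open>On the diagonal the integrand is \<open>1 / sqrt 0 = 0\<close>, so a possible
      point mass there contributes nothing.\<close>
    then show "(if dist \<zeta> \<xi> \<le> t then ennreal (1 / sqrt (dist \<zeta> \<xi>)) else 0)
        \<le> (\<Sum>j. ?c j * indicator (?B j) \<xi>)" by (cases "r > 0") (auto simp: r_def)
  qed
  also have "\<dots> = (\<Sum>j. ?c j * emeasure M (?B j))"
    by (subst nn_integral_suminf) (auto intro!: borel_measurable_times_ennreal borel_measurable_indicator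
          sets_M_I suminf_cong nn_integral_cmult_indicator)
  also have "\<dots> \<le> (\<Sum>j. A * ennreal (2 * sqrt t * (1/2) ^ j))"
  proof (rule suminf_le)
    fix j
    have "?c j * emeasure M (?B j) \<le> ?c j * (A * ennreal (t / 4 ^ j))"
      using t by (intro mult_left_mono growth) auto
    also have "\<dots> = A * (?c j * ennreal (t / 4 ^ j))" by (simp add: mult_ac)
    also have "?c j * ennreal (t / 4 ^ j) = ennreal (2 * 2 ^ j / sqrt t * (t / 4 ^ j))"
      using t by (subst ennreal_mult) auto
    also have "2 * 2 ^ j / sqrt t * (t / 4 ^ j) = 2 * sqrt t * (1/2) ^ j"
    proof -
      have "(4::real) ^ j = 2 ^ j * 2 ^ j" by (simp flip: power_mult_distrib)
      moreover have "t = sqrt t * sqrt t" using t by simp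
      ultimately show ?thesis using t by (simp add: power_one_over divide_simps) 
    qed
    finally show "?c j * emeasure M (?B j) \<le> A * ennreal (2 * sqrt t * (1/2) ^ j)" .
  qed auto
  also have "\<dots> = A * (\<Sum>j. ennreal (2 * sqrt t * (1/2) ^ j))" by (rule ennreal_suminf_cmult)
  also have "(\<Sum>j. ennreal (2 * sqrt t * (1/2) ^ j)) = ennreal (2 * sqrt t * 2)"
    using t geometric_sums[of "1/2::real"] by (intro suminf_ennreal_eq sums_mult) auto
  finally show ?thesis by simp
qed

end

section \<open>Energy of the test functions\<close>

definition bump :: "real \<Rightarrow> real \<Rightarrow> real" where
  "bump t y = max 0 (min 1 (2 - 2 * y / t))"

lemma bump_nonneg: "0 \<le> bump t y" and bump_le_1: "bump t y \<le> 1"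
  by (auto simp: bump_def)

lemma bump_eq_0: "t > 0 \<Longrightarrow> t \<le> y \<Longrightarrow> bump t y = 0"
  by (simp add: bump_def field_simps)

lemma bump_eq_1: "t > 0 \<Longrightarrow> y \<le> t / 2 \<Longrightarrow> bump t y = 1"
  by (simp add: bump_def field_simps)

lemma bump_diff_le_1: "\<bar>bump t x - bump t y\<bar> \<le> 1"
  using bump_nonneg[of t x] bump_nonneg[of t y] bump_le_1[of t x] bump_le_1[of t y] by linarith

lemma bump_lipschitz:
  assumes "t > 0" shows "\<bar>bump t x - bump t y\<bar> \<le> 2 * \<bar>x - y\<bar> / t"
proof -
  have "\<bar>bump t x - bump t y\<bar> \<le> \<bar>2 * x / t - 2 * y / t\<bar>"
    unfolding bump_def by linarith
  also have "\<dots> = 2 * \<bar>x - y\<bar> / t"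
  proof -
    have "2 * x / t - 2 * y / t = 2 * (x - y) / t" by (simp add: diff_divide_distrib right_diff_distrib)
    then show ?thesis using assms by (simp only: abs_mult abs_divide)
  qed
  finally show ?thesis .
qed

text \<open>Split the indices according to whether \<open>2^k\<close> has reached \<open>s\<close>.
  On either side the terms decay at least geometrically away from the index closest to the
  threshold, so each side contributes at most 2.\<close>

lemma sum_geometric_min_le:
  assumes s: "s > 0" and K: "finite K"
  shows "(\<Sum>k\<in>K. min (s / 2 ^ k) (2 ^ k / s)) \<le> (4 :: real)"
proof -
  define A where "A = {k\<in>K. s \<le> 2 ^ k}"
  have fin: "finite A" using K by (simp add: A_def)
  have "(\<Sum>k\<in>A. min (s / 2 ^ k) (2 ^ k / s)) \<le> 2"
  proof (cases "A = {}")
    case False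
    define m where "m = Min A"
    have m: "m \<in> A" "\<And>k. k \<in> A \<Longrightarrow> m \<le> k" using fin False by (auto simp: m_def)
    have ge: "x - m \<in> {..Max A}" if "x \<in> A" for x
      using Max_ge[OF fin that] by simp
    have "(\<Sum>k\<in>A. min (s / 2 ^ k) (2 ^ k / s)) \<le> (\<Sum>k\<in>A. (1/2) ^ (k - m))"
    proof (rule sum_mono)
      fix k assume k: "k \<in> A"
      have "s / 2 ^ k \<le> 2 ^ m / 2 ^ k" using m(1) by (intro divide_right_mono) (auto simp: A_def)
      also have "\<dots> = (1/2) ^ (k - m)" using m(2)[OF k] by (simp add: power_diff power_one_over)
      finally show "min (s / 2 ^ k) (2 ^ k / s) \<le> (1/2) ^ (k - m)" by simp
    qed
    also have "\<dots> = (\<Sum>j\<in>(\<lambda>k. k - m) ` A. (1/2) ^ j)"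
      using m(2) by (subst sum.reindex) (auto simp: inj_on_def intro: eq_diff_iff[THEN iffD1])
    also have "\<dots> \<le> (\<Sum>j. (1/2) ^ j)"
      using fin by (intro sum_le_suminf) auto
    also have "\<dots> = 2" by (simp add: suminf_geometric)
    finally show ?thesis .
  qed simp
  moreover have "(\<Sum>k\<in>K-A. min (s / 2 ^ k) (2 ^ k / s)) \<le> 2"
  proof (cases "K - A = {}")
    case False
    define m where "m = Max (K - A)"
    have m: "m \<in> K - A" "\<And>k. k \<in> K - A \<Longrightarrow> k \<le> m" using K False Max_in[of "K-A"] by (auto simp: m_def)
    have "(\<Sum>k\<in>K-A. min (s / 2 ^ k) (2 ^ k / s)) \<le> (\<Sum>k\<in>K-A. (1/2) ^ (m - k))"
    proof (rule sum_mono)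
      fix k assume k: "k \<in> K - A"
      have "2 ^ k / s \<le> 2 ^ k / 2 ^ m" using m(1) s by (intro divide_left_mono) (auto simp: A_def)
      also have "\<dots> = (1/2) ^ (m - k)" using m(2)[OF k] by (simp add: power_diff power_one_over)
      finally show "min (s / 2 ^ k) (2 ^ k / s) \<le> (1/2) ^ (m - k)" by simp
    qed
    also have "\<dots> = (\<Sum>j\<in>(\<lambda>k. m - k) ` (K - A). (1/2) ^ j)"
    proof -
      have "inj_on (\<lambda>k. m - k) (K - A)" by (rule inj_onI) (metis m(2) diff_diff_cancel)
      then show ?thesis by (subst sum.reindex) auto
    qed
    also have "\<dots> \<le> (\<Sum>j. (1/2) ^ j)"
      using K by (intro sum_le_suminf) auto
    also have "\<dots> = 2" by (simp add: suminf_geometric)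
    finally show ?thesis .
  next
    case True show ?thesis unfolding True by simp
  qed
  moreover have "(\<Sum>k\<in>K. min (s / 2 ^ k) (2 ^ k / s)) = (\<Sum>k\<in>A. min (s / 2 ^ k) (2 ^ k / s)) + (\<Sum>k\<in>K-A. min (s / 2 ^ k) (2 ^ k / s))"
    using K by (subst sum.subset_diff[of A]) (auto simp: A_def)
  ultimately show ?thesis by linarith
qed

text \<open>Schur test: Cauchy-Schwarz with the weights \<open>a k = sqrt (r / t)\<close> for
  \<open>t = 1 / 4 ^ k\<close>. The factor \<open>\<Sum>k\<in>K. D k / a k\<close> is at most 8
  whatever \<open>r\<close> and \<open>K\<close> are, so the square of the sum is controlled by a
  sum of single-scale terms without cross terms.\<close>

lemma sum_bump_diff_square_le:
  fixes c :: "nat \<Rightarrow> real" and x y r :: real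
  assumes K: "finite K" and c: "\<And>k. k \<in> K \<Longrightarrow> 0 \<le> c k" and r: "r > 0" "\<bar>x - y\<bar> \<le> r"
  defines "D \<equiv> \<lambda>k. \<bar>bump (1 / 4 ^ k) x - bump (1 / 4 ^ k) y\<bar>"
  shows "(\<Sum>k\<in>K. c k * D k)\<^sup>2 \<le> 8 * (\<Sum>k\<in>K. (c k)\<^sup>2 * (D k * sqrt (r / (1 / 4 ^ k))))"
proof -
  define a where "a k = sqrt (r / (1 / 4 ^ k))" for k :: nat
  have a: "a k = 2 ^ k * sqrt r" for k by (simp add: a_def real_sqrt_mult real_sqrt_power)
  have a0: "a k > 0" for k using r by (simp add: a)
  have D0: "D k \<ge> 0" for k by (simp add: D_def)
  have "(\<Sum>k\<in>K. c k * D k)\<^sup>2 = (\<Sum>k\<in>K. (c k * sqrt (D k * a k)) * sqrt (D k / a k))\<^sup>2"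
    using a0 D0 by (intro arg_cong[where f = "\<lambda>x. x\<^sup>2"] sum.cong refl)
       (simp add: real_sqrt_mult real_sqrt_divide field_simps less_imp_neq[symmetric])
  also have "\<dots> \<le> (\<Sum>k\<in>K. (c k * sqrt (D k * a k))\<^sup>2) * (\<Sum>k\<in>K. (sqrt (D k / a k))\<^sup>2)"
    by (rule Cauchy_Schwarz_ineq_sum)
  also have "\<dots> = (\<Sum>k\<in>K. (c k)\<^sup>2 * (D k * a k)) * (\<Sum>k\<in>K. D k / a k)"
    using D0 a0 by (simp add: power_mult_distrib less_imp_le)
  finally have CS: "(\<Sum>k\<in>K. c k * D k)\<^sup>2 \<le> (\<Sum>k\<in>K. (c k)\<^sup>2 * (D k * a k)) * (\<Sum>k\<in>K. D k / a k)" .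
  \<comment> \<open>For coarse scales use the Lipschitz bound on \<open>D k\<close>, for fine scales
    the bound 1. After division by \<open>a k = 2^k * sqrt r\<close> these are geometric in opposite
    directions.\<close>
  have "(\<Sum>k\<in>K. D k / a k) \<le> (\<Sum>k\<in>K. 2 * min ((1 / sqrt r) / 2 ^ k) (2 ^ k / (1 / sqrt r)))"
  proof (rule sum_mono)
    fix k
    have "D k \<le> 2 * \<bar>x - y\<bar> / (1 / 4 ^ k)" unfolding D_def by (rule bump_lipschitz) simp
    also have "\<dots> \<le> 2 * r * 4 ^ k" using r by simp
    finally have "D k / a k \<le> 2 * r * 4 ^ k / a k" using a0 by (intro divide_right_mono) (auto simp: less_imp_le)
    also have "\<dots> = 2 * (2 ^ k / (1 / sqrt r))"
    proof -
      have "(4::real) ^ k = 2 ^ k * 2 ^ k" "r = sqrt r * sqrt r" using r by (simp_all flip: power_mult_distrib)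
      then have eq: "2 * r * 4 ^ k = 2 * (2 ^ k * sqrt r) * a k" unfolding a by (metis (no_types) mult.assoc mult.commute)
      show ?thesis unfolding eq using a0[of k] by (subst nonzero_mult_div_cancel_right) auto
    qed
    finally have 1: "D k / a k \<le> 2 * (2 ^ k / (1 / sqrt r))" .
    have "D k / a k \<le> 1 / a k" using a0[of k] bump_diff_le_1 by (intro divide_right_mono) (auto simp: D_def)
    also have "\<dots> \<le> 2 / a k" using a0[of k] by (intro divide_right_mono) auto
    also have "\<dots> = 2 * ((1 / sqrt r) / 2 ^ k)" by (simp add: a)
    finally have 2: "D k / a k \<le> 2 * ((1 / sqrt r) / 2 ^ k)" .
    from 1 2 show "D k / a k \<le> 2 * min ((1 / sqrt r) / 2 ^ k) (2 ^ k / (1 / sqrt r))"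
      by (simp only: min_def) simp
  qed
  also have "\<dots> \<le> 2 * 4"
    unfolding sum_distrib_left[symmetric] using r K
    by (intro mult_left_mono sum_geometric_min_le) auto
  finally have "(\<Sum>k\<in>K. (c k)\<^sup>2 * (D k * a k)) * (\<Sum>k\<in>K. D k / a k) \<le> (\<Sum>k\<in>K. (c k)\<^sup>2 * (D k * a k)) * (2 * 4)"
    using a0 D0 by (intro mult_left_mono) (auto intro!: sum_nonneg mult_nonneg_nonneg simp: less_imp_le)
  with CS show ?thesis by (simp add: a_def mult.commute)
qed

text \<open>For points closer than \<open>t\<close> the kernel must be localised in \<open>\<xi>\<close> only: the singularity
  \<open>|\<xi> - \<zeta>|\<close> to the power \<open>-1/2\<close> is integrable for arc length in \<open>\<zeta>\<close>, but not for \<open>\<mu>\<close> in \<open>\<xi>\<close>.\<close>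

definition nearby_kernel :: "complex set \<Rightarrow> real \<Rightarrow> complex \<Rightarrow> complex \<Rightarrow> ennreal" where
  "nearby_kernel E t \<xi> \<zeta> =
     indicator {\<xi>. infdist \<xi> E < 2 * t} \<xi> * (ennreal (2 / (t * sqrt t)) *
       (if dist \<xi> \<zeta> \<le> t then ennreal (1 / sqrt (dist \<xi> \<zeta>)) else 0))"

definition distant_kernel :: "real \<Rightarrow> complex \<Rightarrow> complex \<Rightarrow> ennreal" where
  "distant_kernel t \<xi> \<zeta> = ennreal (1 / sqrt t) *
     (if t < dist \<xi> \<zeta> then ennreal (1 / (dist \<xi> \<zeta> * sqrt (dist \<xi> \<zeta>))) else 0)"

text \<open>A distant pair contributes as soon as one of its two points is close to
  \<open>E\<close>. The two possibilities are kept as separate terms because they are integrated in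
  different orders.\<close>

definition energy_kernel :: "complex set \<Rightarrow> real \<Rightarrow> complex \<Rightarrow> complex \<Rightarrow> ennreal" where
  "energy_kernel E t \<xi> \<zeta> = nearby_kernel E t \<xi> \<zeta>
     + (indicator {\<xi>. infdist \<xi> E < t} \<xi> * distant_kernel t \<xi> \<zeta>
     + indicator {\<xi>. infdist \<xi> E < t} \<zeta> * distant_kernel t \<xi> \<zeta>)"

text \<open>With \<open>r = dist \<xi> \<zeta>\<close>, the weight
  \<open>sqrt (r/t) / r\<^sup>2\<close> is \<open>1 / sqrt t\<close> times \<open>r\<close> to the
  power -3/2. For \<open>r \<le> t\<close> the Lipschitz bound \<open>2 * r / t\<close> lowers the
  singularity to the power -1/2; for larger \<open>r\<close> the difference of the bumps is just
  bounded by 1.\<close>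

lemma bump_diff_le_energy_kernel:
  assumes t: "t > 0" and r: "\<xi> \<noteq> \<zeta>"
  shows "ennreal (\<bar>bump t (infdist \<xi> E) - bump t (infdist \<zeta> E)\<bar> * sqrt (dist \<xi> \<zeta> / t) / (dist \<xi> \<zeta>)\<^sup>2)
     \<le> energy_kernel E t \<xi> \<zeta>"
proof -
  define r where "r = dist \<xi> \<zeta>"
  have r0: "r > 0" using r by (simp add: r_def)
  define D where "D = \<bar>bump t (infdist \<xi> E) - bump t (infdist \<zeta> E)\<bar>"
  have D0: "D \<ge> 0" by (simp add: D_def)
  have w: "sqrt (r / t) / r\<^sup>2 = 1 / sqrt t * (1 / (r * sqrt r))"
  proof -
    have "r\<^sup>2 = r * (sqrt r * sqrt r)" using r0 by (simp add: power2_eq_square)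
    then show ?thesis using r0 t by (simp add: real_sqrt_divide field_simps del: real_sqrt_mult_self)
  qed
  have inf: "\<bar>infdist \<xi> E - infdist \<zeta> E\<bar> \<le> r"
    using infdist_triangle_abs[of \<xi> E \<zeta>] by (simp add: r_def)
  show ?thesis
  proof (cases "r \<le> t")
    case True
    show ?thesis
    proof (cases "infdist \<xi> E < 2 * t")
      case near: True
      have "D \<le> 2 * \<bar>infdist \<xi> E - infdist \<zeta> E\<bar> / t" unfolding D_def using t by (rule bump_lipschitz)
      also have "\<dots> \<le> 2 * r / t" using inf t by (intro divide_right_mono) auto
      finally have "D * (sqrt (r / t) / r\<^sup>2) \<le> 2 * r / t * (1 / sqrt t * (1 / (r * sqrt r)))"
        unfolding w using t r0 by (intro mult_right_mono) auto
      also have "\<dots> = 2 / (t * sqrt t) * (1 / sqrt r)" using r0 t by (simp add: field_simps)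
      finally have "ennreal (D * (sqrt (r / t) / r\<^sup>2)) \<le> ennreal (2 / (t * sqrt t)) * ennreal (1 / sqrt r)"
        using t r0 by (simp add: ennreal_leI flip: ennreal_mult)
      also have "\<dots> = nearby_kernel E t \<xi> \<zeta>" using near True by (simp add: nearby_kernel_def r_def)
      also have "\<dots> \<le> energy_kernel E t \<xi> \<zeta>" by (simp add: energy_kernel_def)
      finally show ?thesis by (simp add: D_def r_def)
    next
      case False
      \<comment> \<open>If \<open>\<xi>\<close> is at distance at least \<open>2 * t\<close> from
        \<open>E\<close>, then \<open>\<zeta>\<close> is still at distance at least
        \<open>t\<close>, and both bumps vanish. This is the origin of the \<open>2 * t\<close> in
        \<open>nearby_kernel\<close>.\<close>
      then have "D = 0" unfolding D_def using inf True t by (subst (1 2) bump_eq_0) auto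
      then show ?thesis by (simp add: D_def)
    qed
  next
    case False
    show ?thesis
    proof (cases "infdist \<xi> E < t \<or> infdist \<zeta> E < t")
      case near: True
      have "D * (sqrt (r / t) / r\<^sup>2) \<le> 1 * (1 / sqrt t * (1 / (r * sqrt r)))"
        unfolding w D_def using t r0 by (intro mult_right_mono bump_diff_le_1) auto
      then have "ennreal (D * (sqrt (r / t) / r\<^sup>2)) \<le> ennreal (1 / sqrt t) * ennreal (1 / (r * sqrt r))"
        using t r0 by (simp add: ennreal_leI flip: ennreal_mult)
      also have "\<dots> = distant_kernel t \<xi> \<zeta>" using False by (simp add: distant_kernel_def r_def)
      also have "\<dots> \<le> energy_kernel E t \<xi> \<zeta>" using near
        by (auto simp: energy_kernel_def indicator_def intro: order_trans[OF _ add_increasing])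
      finally show ?thesis by (simp add: D_def r_def)
    next
      case far: False
      then have "D = 0" unfolding D_def using t by (subst (1 2) bump_eq_0) auto
      then show ?thesis by (simp add: D_def)
    qed
  qed
qed

section \<open>Test functions for the capacity\<close>

definition test_function :: "complex set \<Rightarrow> (nat \<Rightarrow> real) \<Rightarrow> nat set \<Rightarrow> complex \<Rightarrow> complex" where
  "test_function E c K \<zeta> = complex_of_real (\<Sum>k\<in>K. c k * bump (1 / 4 ^ k) (infdist \<zeta> E))"

lemma dist_test_function_le:
  assumes c: "\<And>k. k \<in> K \<Longrightarrow> 0 \<le> c k"
  shows "dist (test_function E c K \<xi>) (test_function E c K \<zeta>)
     \<le> (\<Sum>k\<in>K. c k * \<bar>bump (1 / 4 ^ k) (infdist \<xi> E) - bump (1 / 4 ^ k) (infdist \<zeta> E)\<bar>)"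
proof -
  have "dist (test_function E c K \<xi>) (test_function E c K \<zeta>)
     = \<bar>\<Sum>k\<in>K. c k * (bump (1 / 4 ^ k) (infdist \<xi> E) - bump (1 / 4 ^ k) (infdist \<zeta> E))\<bar>"
    by (simp add: test_function_def dist_norm right_diff_distrib sum_subtractf
        flip: of_real_diff del: of_real_sum)
  also have "\<dots> \<le> (\<Sum>k\<in>K. \<bar>c k * (bump (1 / 4 ^ k) (infdist \<xi> E) - bump (1 / 4 ^ k) (infdist \<zeta> E))\<bar>)"
    by (rule sum_abs)
  also have "\<dots> = (\<Sum>k\<in>K. c k * \<bar>bump (1 / 4 ^ k) (infdist \<xi> E) - bump (1 / 4 ^ k) (infdist \<zeta> E)\<bar>)"
    using c by (intro sum.cong) (auto simp: abs_mult)
  finally show ?thesis .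
qed

text \<open>The constant is crude. The Lipschitz property is there to identify the boundary values
  and to give measurability, not to estimate the energy.\<close>

lemma lipschitz_on_test_function:
  assumes c: "\<And>k. k \<in> K \<Longrightarrow> 0 \<le> c k"
  shows "(\<Sum>k\<in>K. c k * (2 * 4 ^ k))-lipschitz_on S (test_function E c K)"
proof (rule lipschitz_onI)
  fix \<xi> \<zeta>
  have "dist (test_function E c K \<xi>) (test_function E c K \<zeta>)
     \<le> (\<Sum>k\<in>K. c k * \<bar>bump (1 / 4 ^ k) (infdist \<xi> E) - bump (1 / 4 ^ k) (infdist \<zeta> E)\<bar>)"
    using c by (rule dist_test_function_le)
  also have "\<dots> \<le> (\<Sum>k\<in>K. c k * (2 * 4 ^ k * dist \<xi> \<zeta>))"
  proof (intro sum_mono mult_left_mono c)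
    fix k :: nat
    have "\<bar>bump (1 / 4 ^ k) (infdist \<xi> E) - bump (1 / 4 ^ k) (infdist \<zeta> E)\<bar>
       \<le> 2 * \<bar>infdist \<xi> E - infdist \<zeta> E\<bar> / (1 / 4 ^ k)" by (rule bump_lipschitz) simp
    also have "\<dots> \<le> 2 * 4 ^ k * dist \<xi> \<zeta>" using infdist_triangle_abs[of \<xi> E \<zeta>] by simp
    finally show "\<bar>bump (1 / 4 ^ k) (infdist \<xi> E) - bump (1 / 4 ^ k) (infdist \<zeta> E)\<bar> \<le> 2 * 4 ^ k * dist \<xi> \<zeta>" .
  qed
  also have "\<dots> = (\<Sum>k\<in>K. c k * (2 * 4 ^ k)) * dist \<xi> \<zeta>"
    by (simp add: sum_distrib_right mult.assoc)
  finally show "dist (test_function E c K \<xi>) (test_function E c K \<zeta>) \<le> (\<Sum>k\<in>K. c k * (2 * 4 ^ k)) * dist \<xi> \<zeta>" .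
qed (use c in \<open>auto intro!: sum_nonneg\<close>)

lemma test_function_difference_quotient_le:
  assumes K: "finite K" and c: "\<And>k. k \<in> K \<Longrightarrow> 0 \<le> c k"
  shows "ennreal ((dist (test_function E c K \<zeta>) (test_function E c K \<xi>))\<^sup>2 / (dist \<zeta> \<xi>)\<^sup>2)
     \<le> (\<Sum>k\<in>K. ennreal (8 * (c k)\<^sup>2) * energy_kernel E (1 / 4 ^ k) \<xi> \<zeta>)"
\<comment> \<open>On the diagonal the quotient is \<open>0 / 0 = 0\<close>, so only distinct points
  matter.\<close>
proof (cases "\<xi> = \<zeta>")
  case False
  define r where "r = dist \<xi> \<zeta>"
  have r: "r > 0" using False by (simp add: r_def)
  define D where "D k = \<bar>bump (1 / 4 ^ k) (infdist \<xi> E) - bump (1 / 4 ^ k) (infdist \<zeta> E)\<bar>" for k :: nat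
  have "(dist (test_function E c K \<zeta>) (test_function E c K \<xi>))\<^sup>2 \<le> (\<Sum>k\<in>K. c k * D k)\<^sup>2"
    unfolding dist_commute[of "test_function E c K \<zeta>"] D_def
    using c by (intro power_mono dist_test_function_le) auto
  also have "\<dots> \<le> 8 * (\<Sum>k\<in>K. (c k)\<^sup>2 * (D k * sqrt (r / (1 / 4 ^ k))))"
    unfolding D_def using K c r infdist_triangle_abs[of \<xi> E \<zeta>]
    by (intro sum_bump_diff_square_le) (auto simp: r_def)
  finally have "(dist (test_function E c K \<zeta>) (test_function E c K \<xi>))\<^sup>2 / r\<^sup>2
     \<le> 8 * (\<Sum>k\<in>K. (c k)\<^sup>2 * (D k * sqrt (r / (1 / 4 ^ k)))) / r\<^sup>2"
    by (rule divide_right_mono) simp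
  also have "\<dots> = (\<Sum>k\<in>K. (8 * (c k)\<^sup>2) * (D k * sqrt (r / (1 / 4 ^ k)) / r\<^sup>2))"
    by (simp add: sum_distrib_left sum_divide_distrib mult.assoc)
  finally have "ennreal ((dist (test_function E c K \<zeta>) (test_function E c K \<xi>))\<^sup>2 / r\<^sup>2)
     \<le> ennreal (\<Sum>k\<in>K. (8 * (c k)\<^sup>2) * (D k * sqrt (r / (1 / 4 ^ k)) / r\<^sup>2))"
    by (rule ennreal_leI)
  also have "\<dots> = (\<Sum>k\<in>K. ennreal (8 * (c k)\<^sup>2) * ennreal (D k * sqrt (r / (1 / 4 ^ k)) / r\<^sup>2))"
    by (subst sum_ennreal[symmetric]) (use r in \<open>auto simp: D_def intro!: sum.cong simp del: ennreal_numeral simp flip: ennreal_mult\<close>)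
  also have "\<dots> \<le> (\<Sum>k\<in>K. ennreal (8 * (c k)\<^sup>2) * energy_kernel E (1 / 4 ^ k) \<xi> \<zeta>)"
    unfolding D_def r_def using False by (intro sum_mono mult_left_mono bump_diff_le_energy_kernel) auto
  finally show ?thesis by (simp add: r_def dist_commute)
qed simp

lemma borel_measurable_infdist' [measurable]:
  "f \<in> borel_measurable N \<Longrightarrow> (\<lambda>x. infdist (f x) (E :: complex set)) \<in> borel_measurable N"
  by (rule measurable_compose[where N = borel])
     (auto intro!: borel_measurable_continuous_onI continuous_intros)

section \<open>The energy of a single scale\<close>

context finite_circle_measure
begin

text \<open>Sums of kernels are split on the product space, where joint measurability is all that
  additivity asks for.\<close>

lemma nn_integral_circle_pair:
  fixes f :: "complex \<Rightarrow> complex \<Rightarrow> ennreal"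
  assumes "case_prod f \<in> borel_measurable (borel \<Otimes>\<^sub>M borel)"
  shows "(\<integral>\<^sup>+\<xi>. \<integral>\<^sup>+\<zeta>. f \<xi> \<zeta> \<partial>circle_measure \<partial>M) = (\<integral>\<^sup>+p. case_prod f p \<partial>(M \<Otimes>\<^sub>M circle_measure))"
proof -
  interpret S: finite_measure circle_measure by (rule finite_measure_circle_measure)
  show ?thesis using S.nn_integral_fst[OF borel_measurable_pair_M[OF assms]] by simp
qed

text \<open>Double counting with radius \<open>t\<close>, which trades the
  \<open>\<mu>\<close>-measure of a neighbourhood of \<open>E\<close> for the length of a slightly
  larger one.\<close>

lemma emeasure_neighbourhood_double:
  assumes t: "0 < t" "t \<le> 1"
  shows "emeasure M (circle \<inter> {\<xi>. infdist \<xi> E < 2 * t})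
    \<le> ball_modulus t * emeasure circle_measure (circle \<inter> {\<xi>. infdist \<xi> E < 3 * t}) * ennreal (2 * pi / t)"
proof -
  have "ennreal (t / (2 * pi)) * emeasure M (circle \<inter> {\<xi>. infdist \<xi> E < 2 * t})
    \<le> ball_modulus t * emeasure circle_measure (circle \<inter> {\<xi>. infdist \<xi> E < 3 * t})"
  proof (rule emeasure_neighbourhood)
    show "t \<le> pi" using t pi_gt3 by simp
    show "circle \<inter> ball \<xi> t \<subseteq> {\<xi>. infdist \<xi> E < 3 * t}"
      if "\<xi> \<in> circle \<inter> {\<xi>. infdist \<xi> E < 2 * t}" for \<xi>
    proof
      fix \<zeta> assume "\<zeta> \<in> circle \<inter> ball \<xi> t"
      then show "\<zeta> \<in> {\<xi>. infdist \<xi> E < 3 * t}"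
        using that infdist_triangle[of \<zeta> E \<xi>] by (simp add: dist_commute)
    qed
  qed (use t in \<open>auto intro!: sets_M_I\<close>)
  then have le: "ennreal (t / (2 * pi)) * emeasure M (circle \<inter> {\<xi>. infdist \<xi> E < 2 * t}) * ennreal (2 * pi / t)
    \<le> ball_modulus t * emeasure circle_measure (circle \<inter> {\<xi>. infdist \<xi> E < 3 * t}) * ennreal (2 * pi / t)"
    by (rule mult_right_mono) simp
  have "ennreal (t / (2 * pi)) * ennreal (2 * pi / t) = 1"
    using t by (simp flip: ennreal_mult'')
  then have "emeasure M (circle \<inter> {\<xi>. infdist \<xi> E < 2 * t})
    = ennreal (t / (2 * pi)) * emeasure M (circle \<inter> {\<xi>. infdist \<xi> E < 2 * t}) * ennreal (2 * pi / t)"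
    by (subst mult.commute, subst mult.assoc[symmetric]) (simp add: mult.commute)
  with le show ?thesis by (simp only:)
qed

text \<open>The two terms localised in \<open>\<xi>\<close> are integrated in \<open>\<zeta>\<close>
  first, where arc length has growth constant 2; each gives \<open>16 / t\<close> times the
  \<open>\<mu>\<close>-measure of the \<open>2 * t\<close>-neighbourhood. The term localised in
  \<open>\<zeta>\<close> is integrated in \<open>\<xi>\<close> first. After
  \<open>emeasure_neighbourhood_double\<close> the constants add up as
  \<open>32 * pi + 32 * pi + 64 * pi\<close>.\<close>

lemma energy_kernel_integral_le:
  assumes t: "0 < t" "t \<le> 1"
  shows "(\<integral>\<^sup>+\<xi>. \<integral>\<^sup>+\<zeta>. energy_kernel E t \<xi> \<zeta> \<partial>circle_measure \<partial>M)
    \<le> ball_modulus t * emeasure circle_measure (circle \<inter> {\<xi>. infdist \<xi> E < 3 * t}) * ennreal (128 * pi / t\<^sup>2)"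
proof -
  interpret \<sigma>: finite_circle_measure circle_measure by (rule finite_circle_measure_circle_measure)
  let ?E = "\<lambda>s. circle \<inter> {\<xi>. infdist \<xi> E < s}"
  define N F1 F2 where "N = nearby_kernel E t"
    and "F1 = (\<lambda>\<xi> \<zeta>. indicator {\<xi>. infdist \<xi> E < t} \<xi> * distant_kernel t \<xi> \<zeta>)"
    and "F2 = (\<lambda>\<xi> \<zeta>. indicator {\<xi>. infdist \<xi> E < t} \<zeta> * distant_kernel t \<xi> \<zeta>)"
  have [measurable]: "case_prod N \<in> borel_measurable (borel \<Otimes>\<^sub>M borel)"
    unfolding N_def nearby_kernel_def by measurable
  have [measurable]: "case_prod F1 \<in> borel_measurable (borel \<Otimes>\<^sub>M borel)"
    "case_prod F2 \<in> borel_measurable (borel \<Otimes>\<^sub>M borel)"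
    unfolding F1_def F2_def distant_kernel_def by measurable
  have cm: "emeasure circle_measure (circle \<inter> cball \<xi> r) \<le> ennreal 2 * ennreal r" if "\<xi> \<in> circle" "r \<ge> 0" for \<xi> r
    using circle_measure_cball_le[OF that] that by (subst ennreal_mult[symmetric]) auto
  have N: "(\<integral>\<^sup>+\<xi>. \<integral>\<^sup>+\<zeta>. N \<xi> \<zeta> \<partial>circle_measure \<partial>M) \<le> ennreal (16 / t) * emeasure M (?E (2 * t))"
  proof -
    have "(\<integral>\<^sup>+\<xi>. \<integral>\<^sup>+\<zeta>. N \<xi> \<zeta> \<partial>circle_measure \<partial>M) \<le> (\<integral>\<^sup>+\<xi>. ennreal (16 / t) * indicator (?E (2*t)) \<xi> \<partial>M)"
    proof (rule nn_integral_mono)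
      fix \<xi> assume "\<xi> \<in> space M"
      then have \<xi>: "\<xi> \<in> circle" by (simp add: space_M)
      have "(\<integral>\<^sup>+\<zeta>. N \<xi> \<zeta> \<partial>circle_measure) = indicator (?E (2*t)) \<xi> * (ennreal (2 / (t * sqrt t)) *
         (\<integral>\<^sup>+\<zeta>. (if dist \<xi> \<zeta> \<le> t then ennreal (1 / sqrt (dist \<xi> \<zeta>)) else 0) \<partial>circle_measure))"
        unfolding N_def nearby_kernel_def using \<xi>
        by (subst nn_integral_cmult, measurable)+ (simp add: indicator_def)
      also have "\<dots> \<le> indicator (?E (2*t)) \<xi> * (ennreal (2 / (t * sqrt t)) * (ennreal 2 * ennreal (4 * sqrt t)))"
        using t \<xi> cm by (intro mult_left_mono \<sigma>.kernel_near) auto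
      also have "ennreal (2 / (t * sqrt t)) * (ennreal 2 * ennreal (4 * sqrt t)) = ennreal (2 / (t * sqrt t) * (2 * (4 * sqrt t)))"
        using t by (simp del: ennreal_numeral flip: ennreal_mult'')
      also have "2 / (t * sqrt t) * (2 * (4 * sqrt t)) = 16 / t" using t by simp
      finally show "(\<integral>\<^sup>+\<zeta>. N \<xi> \<zeta> \<partial>circle_measure) \<le> ennreal (16 / t) * indicator (?E (2*t)) \<xi>"
        by (simp add: mult.commute)
    qed
    also have "\<dots> = ennreal (16 / t) * emeasure M (?E (2 * t))"
      by (rule nn_integral_cmult_indicator) (rule sets_M_I, measurable)
    finally show ?thesis .
  qed
  have F1: "(\<integral>\<^sup>+\<xi>. \<integral>\<^sup>+\<zeta>. F1 \<xi> \<zeta> \<partial>circle_measure \<partial>M) \<le> ennreal (16 / t) * emeasure M (?E (2 * t))"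
  proof -
    have "(\<integral>\<^sup>+\<xi>. \<integral>\<^sup>+\<zeta>. F1 \<xi> \<zeta> \<partial>circle_measure \<partial>M) \<le> (\<integral>\<^sup>+\<xi>. ennreal (16 / t) * indicator (?E (2*t)) \<xi> \<partial>M)"
    proof (rule nn_integral_mono)
      fix \<xi> assume "\<xi> \<in> space M"
      then have \<xi>: "\<xi> \<in> circle" by (simp add: space_M)
      have m: "(\<lambda>\<zeta>. if t < dist \<xi> \<zeta> then ennreal (1 / (dist \<xi> \<zeta> * sqrt (dist \<xi> \<zeta>))) else 0) \<in> borel_measurable circle_measure"
        by (rule measurable_circle_measureI) measurable
      have "(\<integral>\<^sup>+\<zeta>. F1 \<xi> \<zeta> \<partial>circle_measure) = indicator {\<xi>. infdist \<xi> E < t} \<xi> * (ennreal (1 / sqrt t) *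
         (\<integral>\<^sup>+\<zeta>. (if t < dist \<xi> \<zeta> then ennreal (1 / (dist \<xi> \<zeta> * sqrt (dist \<xi> \<zeta>))) else 0) \<partial>circle_measure))"
        unfolding F1_def distant_kernel_def using m by (simp add: nn_integral_cmult)
      also have "\<dots> \<le> indicator (?E (2*t)) \<xi> * (ennreal (1 / sqrt t) * (ennreal 2 * ennreal (8 / sqrt t)))"
        using t \<xi> cm by (intro mult_mono mult_left_mono \<sigma>.kernel_far) (auto simp: indicator_def)
      also have "ennreal (1 / sqrt t) * (ennreal 2 * ennreal (8 / sqrt t)) = ennreal (1 / sqrt t * (2 * (8 / sqrt t)))"
        using t by (simp del: ennreal_numeral flip: ennreal_mult'')
      also have "1 / sqrt t * (2 * (8 / sqrt t)) = 16 / t" using t by simp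
      finally show "(\<integral>\<^sup>+\<zeta>. F1 \<xi> \<zeta> \<partial>circle_measure) \<le> ennreal (16 / t) * indicator (?E (2*t)) \<xi>"
        by (simp add: mult.commute)
    qed
    also have "\<dots> = ennreal (16 / t) * emeasure M (?E (2 * t))"
      by (rule nn_integral_cmult_indicator) (rule sets_M_I, measurable)
    finally show ?thesis .
  qed
  \<comment> \<open>Here the order is exchanged. The growth constant of \<open>\<mu>\<close> from
    radius \<open>t\<close> on is \<open>8 * pi / t\<close> times \<open>ball_modulus t\<close>, by
    \<open>emeasure_cball_le\<close>, and \<open>kernel_far\<close> only looks at such
    radii.\<close>
  have F2: "(\<integral>\<^sup>+\<xi>. \<integral>\<^sup>+\<zeta>. F2 \<xi> \<zeta> \<partial>circle_measure \<partial>M)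
     \<le> ball_modulus t * ennreal (64 * pi / t\<^sup>2) * emeasure circle_measure (?E (3 * t))"
  proof -
    have "(\<integral>\<^sup>+\<xi>. \<integral>\<^sup>+\<zeta>. F2 \<xi> \<zeta> \<partial>circle_measure \<partial>M) = (\<integral>\<^sup>+\<zeta>. \<integral>\<^sup>+\<xi>. F2 \<xi> \<zeta> \<partial>M \<partial>circle_measure)"
      by (rule Fubini_circle) measurable
    also have "\<dots> \<le> (\<integral>\<^sup>+\<zeta>. (ball_modulus t * ennreal (64 * pi / t\<^sup>2)) * indicator (?E (3*t)) \<zeta> \<partial>circle_measure)"
    proof (rule nn_integral_mono)
      fix \<zeta> assume "\<zeta> \<in> space circle_measure"
      then have \<zeta>: "\<zeta> \<in> circle" by simp
      have m: "(\<lambda>\<xi>. if t < dist \<zeta> \<xi> then ennreal (1 / (dist \<zeta> \<xi> * sqrt (dist \<zeta> \<xi>))) else 0) \<in> borel_measurable M"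
        by (rule borel_measurable_M) measurable
      have "(\<integral>\<^sup>+\<xi>. F2 \<xi> \<zeta> \<partial>M) = indicator {\<xi>. infdist \<xi> E < t} \<zeta> * (ennreal (1 / sqrt t) *
         (\<integral>\<^sup>+\<xi>. (if t < dist \<zeta> \<xi> then ennreal (1 / (dist \<zeta> \<xi> * sqrt (dist \<zeta> \<xi>))) else 0) \<partial>M))"
        unfolding F2_def distant_kernel_def dist_commute[of _ \<zeta>]
        using m by (simp add: nn_integral_cmult)
      also have "\<dots> \<le> indicator (?E (3*t)) \<zeta> * (ennreal (1 / sqrt t) * (ball_modulus t * ennreal (8 * pi / t) * ennreal (8 / sqrt t)))"
      proof (intro mult_mono mult_left_mono kernel_far)
        fix r assume r: "t \<le> r"
        have "emeasure M (circle \<inter> cball \<zeta> r) \<le> ball_modulus t * ennreal (8 * pi * r / t)"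
          using t r \<zeta> pi_gt3 by (intro emeasure_cball_le) auto
        also have "ennreal (8 * pi * r / t) = ennreal (8 * pi / t) * ennreal r"
          using t r by (simp flip: ennreal_mult)
        finally show "emeasure M (circle \<inter> cball \<zeta> r) \<le> ball_modulus t * ennreal (8 * pi / t) * ennreal r"
          by (simp add: mult.assoc)
      qed (use t \<zeta> in \<open>auto simp: indicator_def\<close>)
      also have "ennreal (1 / sqrt t) * (ball_modulus t * ennreal (8 * pi / t) * ennreal (8 / sqrt t))
         = ball_modulus t * (ennreal (1 / sqrt t) * (ennreal (8 * pi / t) * ennreal (8 / sqrt t)))"
        by (simp add: mult_ac)
      also have "ennreal (1 / sqrt t) * (ennreal (8 * pi / t) * ennreal (8 / sqrt t))
          = ennreal (1 / sqrt t * (8 * pi / t * (8 / sqrt t)))"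
        using t by (simp del: ennreal_numeral flip: ennreal_mult'')
      also have "1 / sqrt t * (8 * pi / t * (8 / sqrt t)) = 64 * pi / t\<^sup>2"
        using t by (simp add: power2_eq_square)
      finally show "(\<integral>\<^sup>+\<xi>. F2 \<xi> \<zeta> \<partial>M) \<le> (ball_modulus t * ennreal (64 * pi / t\<^sup>2)) * indicator (?E (3*t)) \<zeta>"
        by (simp add: mult.commute)
    qed
    also have "\<dots> = (ball_modulus t * ennreal (64 * pi / t\<^sup>2)) * emeasure circle_measure (?E (3 * t))"
      by (rule nn_integral_cmult_indicator) (rule \<sigma>.sets_M_I, measurable)
    finally show ?thesis .
  qed
  let ?X = "ball_modulus t * emeasure circle_measure (?E (3 * t))"
  have "(\<integral>\<^sup>+\<xi>. \<integral>\<^sup>+\<zeta>. energy_kernel E t \<xi> \<zeta> \<partial>circle_measure \<partial>M)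
     = (\<integral>\<^sup>+\<xi>. \<integral>\<^sup>+\<zeta>. N \<xi> \<zeta> + (F1 \<xi> \<zeta> + F2 \<xi> \<zeta>) \<partial>circle_measure \<partial>M)"
    by (simp add: energy_kernel_def N_def F1_def F2_def)
  also have "\<dots> = (\<integral>\<^sup>+p. case_prod (\<lambda>\<xi> \<zeta>. N \<xi> \<zeta> + (F1 \<xi> \<zeta> + F2 \<xi> \<zeta>)) p \<partial>(M \<Otimes>\<^sub>M circle_measure))"
    by (rule nn_integral_circle_pair) measurable
  also have "\<dots> = (\<integral>\<^sup>+p. case_prod N p + (case_prod F1 p + case_prod F2 p) \<partial>(M \<Otimes>\<^sub>M circle_measure))"
    by (simp add: case_prod_unfold)
  also have "\<dots> = (\<integral>\<^sup>+p. case_prod N p \<partial>(M \<Otimes>\<^sub>M circle_measure))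
     + ((\<integral>\<^sup>+p. case_prod F1 p \<partial>(M \<Otimes>\<^sub>M circle_measure)) + (\<integral>\<^sup>+p. case_prod F2 p \<partial>(M \<Otimes>\<^sub>M circle_measure)))"
    by (subst nn_integral_add; (subst nn_integral_add)?)
       (auto intro!: borel_measurable_pair_M borel_measurable_add)
  also have "\<dots> = (\<integral>\<^sup>+\<xi>. \<integral>\<^sup>+\<zeta>. N \<xi> \<zeta> \<partial>circle_measure \<partial>M)
     + ((\<integral>\<^sup>+\<xi>. \<integral>\<^sup>+\<zeta>. F1 \<xi> \<zeta> \<partial>circle_measure \<partial>M) + (\<integral>\<^sup>+\<xi>. \<integral>\<^sup>+\<zeta>. F2 \<xi> \<zeta> \<partial>circle_measure \<partial>M))"
    by (simp add: nn_integral_circle_pair)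
  also have "\<dots> \<le> ennreal (16 / t) * (?X * ennreal (2 * pi / t)) + (ennreal (16 / t) * (?X * ennreal (2 * pi / t))
      + ball_modulus t * ennreal (64 * pi / t\<^sup>2) * emeasure circle_measure (?E (3 * t)))"
    using emeasure_neighbourhood_double[OF t]
    by (intro add_mono F2 order_trans[OF N] order_trans[OF F1] mult_left_mono) auto
  also have "\<dots> = ?X * (ennreal (16 / t) * ennreal (2 * pi / t) + (ennreal (16 / t) * ennreal (2 * pi / t) + ennreal (64 * pi / t\<^sup>2)))"
    by (simp add: distrib_left mult_ac)
  also have "ennreal (16 / t) * ennreal (2 * pi / t) + (ennreal (16 / t) * ennreal (2 * pi / t) + ennreal (64 * pi / t\<^sup>2))
     = ennreal (16 / t * (2 * pi / t) + (16 / t * (2 * pi / t) + 64 * pi / t\<^sup>2))"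
    using t by (simp flip: ennreal_mult'' ennreal_plus)
  also have "16 / t * (2 * pi / t) + (16 / t * (2 * pi / t) + 64 * pi / t\<^sup>2) = 128 * pi / t\<^sup>2"
    using t by (simp add: power2_eq_square)
  finally show ?thesis .
qed

lemma dirichlet_integral_test_function_le:
  assumes K: "finite K" and c: "\<And>k. k \<in> K \<Longrightarrow> 0 \<le> c k"
  shows "dirichlet_integral M (test_function E c K)
    \<le> (\<Sum>k\<in>K. ennreal (8 * (c k)\<^sup>2) * (ball_modulus (1 / 4 ^ k) *
          emeasure circle_measure (circle \<inter> {\<xi>. infdist \<xi> E < 3 * (1 / 4 ^ k)}) * ennreal (128 * pi / (1 / 4 ^ k)\<^sup>2)))"
proof -
  let ?e = "\<lambda>k. energy_kernel E (1 / 4 ^ k)"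
  have [measurable]: "case_prod (?e k) \<in> borel_measurable (borel \<Otimes>\<^sub>M borel)" for k
    unfolding energy_kernel_def nearby_kernel_def distant_kernel_def by measurable
  have "dirichlet_integral M (test_function E c K)
      \<le> (\<integral>\<^sup>+\<xi>. \<integral>\<^sup>+\<zeta>. (\<Sum>k\<in>K. ennreal (8 * (c k)\<^sup>2) * ?e k \<xi> \<zeta>) \<partial>circle_measure \<partial>M)"
    unfolding dirichlet_integral_def
  proof (rule nn_integral_mono)
    fix \<xi> assume "\<xi> \<in> space M"
    then have "\<xi> \<in> circle" by (simp add: space_M)
    from local_dirichlet_integral_lipschitz[OF lipschitz_on_test_function[OF c] this]
    show "local_dirichlet_integral (test_function E c K) \<xi>
        \<le> (\<integral>\<^sup>+\<zeta>. (\<Sum>k\<in>K. ennreal (8 * (c k)\<^sup>2) * ?e k \<xi> \<zeta>) \<partial>circle_measure)"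
      using test_function_difference_quotient_le[OF K c] by (simp add: nn_integral_mono)
  qed
  also have "\<dots> = (\<integral>\<^sup>+p. case_prod (\<lambda>\<xi> \<zeta>. \<Sum>k\<in>K. ennreal (8 * (c k)\<^sup>2) * ?e k \<xi> \<zeta>) p \<partial>(M \<Otimes>\<^sub>M circle_measure))"
    by (rule nn_integral_circle_pair) measurable
  also have "\<dots> = (\<integral>\<^sup>+p. (\<Sum>k\<in>K. ennreal (8 * (c k)\<^sup>2) * case_prod (?e k) p) \<partial>(M \<Otimes>\<^sub>M circle_measure))"
    by (simp add: case_prod_unfold)
  also have "\<dots> = (\<Sum>k\<in>K. ennreal (8 * (c k)\<^sup>2) * (\<integral>\<^sup>+p. case_prod (?e k) p \<partial>(M \<Otimes>\<^sub>M circle_measure)))"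
    by (subst nn_integral_sum)
       (auto intro!: borel_measurable_times_ennreal borel_measurable_pair_M sum.cong nn_integral_cmult)
  also have "\<dots> = (\<Sum>k\<in>K. ennreal (8 * (c k)\<^sup>2) * (\<integral>\<^sup>+\<xi>. \<integral>\<^sup>+\<zeta>. ?e k \<xi> \<zeta> \<partial>circle_measure \<partial>M))"
    by (simp add: nn_integral_circle_pair)
  also have "\<dots> \<le> (\<Sum>k\<in>K. ennreal (8 * (c k)\<^sup>2) * (ball_modulus (1 / 4 ^ k) *
          emeasure circle_measure (circle \<inter> {\<xi>. infdist \<xi> E < 3 * (1 / 4 ^ k)}) * ennreal (128 * pi / (1 / 4 ^ k)\<^sup>2)))"
    by (intro sum_mono mult_left_mono energy_kernel_integral_le) (auto simp: divide_le_eq)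
  finally show ?thesis .
qed

end

section \<open>Gaps\<close>

text \<open>The circle is locally connected, so components of relatively open subsets are relatively
  open.\<close>

lemma openin_gap:
  assumes "closed E" "I \<in> components (circle - E)"
  shows "openin (top_of_set circle) I"
proof -
  have op: "openin (top_of_set circle) (circle - E)"
    using assms(1) by (auto simp: openin_open intro!: exI[of _ "- E"])
  then have "locally connected (circle - E)"
    by (rule locally_open_subset[OF locally_connected_sphere])
  then have "openin (top_of_set (circle - E)) I"
    using assms(2) by (rule openin_components_locally_connected)
  then show ?thesis using op by (rule openin_trans)
qed

lemma gap_borel:
  assumes "closed E" "I \<in> components (circle - E)"
  shows "I \<in> sets borel"
proof -
  obtain T where "open T" "I = circle \<inter> T" using openin_gap[OF assms] by (auto simp: openin_open)
  then show ?thesis by auto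
qed

text \<open>By the Lindelof property a countable subfamily has the same union, and disjointness of
  components forces it to be the whole family.\<close>

lemma countable_gaps:
  assumes "closed E"
  shows "countable (components (circle - E))"
proof -
  let ?C = "components (circle - E)"
  obtain C' where C': "C' \<subseteq> ?C" "countable C'" "\<Union>C' = \<Union>?C"
    using Lindelof_openin[of ?C circle] openin_gap[OF assms] by metis
  have "?C \<subseteq> C'"
  proof
    fix I assume I: "I \<in> ?C"
    then obtain x where x: "x \<in> I" using in_components_nonempty by blast
    then obtain J where J: "J \<in> C'" "x \<in> J" using C'(3) I by blast
    then have "I = J" using components_nonoverlap[OF I, of J] C'(1) x by blast
    then show "I \<in> C'" using J by simp
  qed
  then show ?thesis using C'(2) countable_subset by blast
qed

section \<open>Length of the neighbourhoods of \<open>E\<close> in terms of the gaps\<close>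

text \<open>A gap is an arc, and its points close to \<open>E\<close> are close to one of its two
  end points, because a short arc from such a point to \<open>E\<close> has to leave the gap. Hence
  two balls of radius \<open>pi * t / 2\<close> cover them, each of measure at most
  \<open>pi * t\<close>.\<close>

lemma emeasure_gap_neighbourhood_le:
  assumes E: "E \<subseteq> circle" "E \<noteq> {}" and I: "I \<in> components (circle - E)" and t: "t > 0"
  shows "emeasure circle_measure (I \<inter> {\<zeta>. infdist \<zeta> E < t}) \<le> ennreal (2 * pi * t)"
proof -
  interpret \<sigma>: finite_circle_measure circle_measure by (rule finite_circle_measure_circle_measure)
  obtain p where p: "p \<in> E" using E by blast
  then have np: "cmod p = 1" and p0: "p \<noteq> 0" using E by auto
  define g where "g \<zeta> = Arg2pi (\<zeta> / p)" for \<zeta>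
  have g: "0 \<le> g \<zeta>" "g \<zeta> < 2 * pi" for \<zeta> using Arg2pi[of "\<zeta> / p"] by (auto simp: g_def)
  have cisg: "p * cis (g \<zeta>) = \<zeta>" if "\<zeta> \<in> circle" for \<zeta>
  proof -
    have "cmod (\<zeta> / p) = 1" using that np by (simp add: norm_divide)
    then have "cis (g \<zeta>) = \<zeta> / p" unfolding g_def by (metis cis_conv_exp complex_norm_eq_1_exp)
    then show ?thesis using p0 by simp
  qed
  have Isub: "I \<subseteq> circle - E" using I by (rule in_components_subset)
  have "continuous_on I g"
  proof (rule continuous_at_imp_continuous_on, rule ballI)
    fix \<zeta> assume \<zeta>: "\<zeta> \<in> I"
    have "\<zeta> / p \<notin> \<real>\<^sub>\<ge>\<^sub>0"
    proof
      assume "\<zeta> / p \<in> \<real>\<^sub>\<ge>\<^sub>0"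
      then obtain r where r: "r \<ge> 0" "\<zeta> / p = of_real r" by (auto elim: nonneg_Reals_cases)
      have "cmod (\<zeta> / p) = 1" using \<zeta> Isub np by (auto simp: norm_divide)
      then have "r = 1" using r by simp
      then have "\<zeta> = p" using r p0 by (simp add: field_simps)
      then show False using \<zeta> Isub p by auto
    qed
    then have "isCont Arg2pi (\<zeta> / p)" by (rule continuous_at_Arg2pi)
    then show "isCont g \<zeta>" unfolding g_def
      by (rule isCont_o2[rotated]) (intro continuous_intros p0)
  qed
  then have "connected (g ` I)"
    using in_components_connected[OF I] by (rule connected_continuous_image)
  then have int: "is_interval (g ` I)" by (simp add: is_interval_connected_1)
  have bdd: "bdd_below (g ` I)" "bdd_above (g ` I)"
    using g by (auto intro!: bdd_belowI[of _ 0] bdd_aboveI[of _ "2*pi"] simp: less_imp_le)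
  have ne: "g ` I \<noteq> {}" using in_components_nonempty[OF I] by simp
  define a where "a = Inf (g ` I)"
  define b where "b = Sup (g ` I)"
  have ab: "a \<le> g \<zeta>" "g \<zeta> \<le> b" if "\<zeta> \<in> I" for \<zeta>
    using that bdd by (auto simp: a_def b_def intro: cInf_lower cSup_upper)
  have a0: "0 \<le> a" unfolding a_def using ne g by (intro cInf_greatest) auto
  have b2: "b \<le> 2 * pi" unfolding b_def using ne g by (intro cSup_least) (auto simp: less_imp_le)
  have outside: "\<tau> \<le> a \<or> b \<le> \<tau>" if "\<tau> \<notin> g ` I" for \<tau>
  proof (rule ccontr)
    assume "\<not> ?thesis"
    then have "a < \<tau>" "\<tau> < b" by auto
    then obtain x y where "x \<in> g ` I" "x < \<tau>" "y \<in> g ` I" "\<tau> < y"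
      using cInf_lessD[OF ne] less_cSupD[OF ne] unfolding a_def b_def by metis
    then have "\<tau> \<in> g ` I" using int unfolding is_interval_1 by (meson less_imp_le)
    then show False using that by simp
  qed
  let ?B = "\<lambda>x. circle \<inter> cball (p * cis x) (pi * t / 2)"
  have "I \<inter> {\<zeta>. infdist \<zeta> E < t} \<subseteq> ?B a \<union> ?B b"
  proof
    fix \<zeta> assume "\<zeta> \<in> I \<inter> {\<zeta>. infdist \<zeta> E < t}"
    then have \<zeta>: "\<zeta> \<in> I" "infdist \<zeta> E < t" by auto
    then have \<zeta>c: "\<zeta> \<in> circle" using Isub by auto
    obtain q where q: "q \<in> E" "dist \<zeta> q < t"
      using \<zeta>(2) E(2) by (auto simp: infdist_def cINF_less_iff split: if_splits)
    have qc: "q \<in> circle" using q E by auto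
    have qI: "g q \<notin> g ` I"
    proof
      assume "g q \<in> g ` I"
      then obtain z where z: "z \<in> I" "g q = g z" by auto
      then have "q = z" using cisg[OF qc] cisg[of z] Isub by auto
      then show False using z q Isub by auto
    qed
    have pd: "dist (p * cis x) (p * cis y) = dist (cis x) (cis y)" for x y
      using np by (simp add: dist_norm norm_mult flip: right_diff_distrib)
    have close: "\<bar>g \<zeta> - \<tau>\<bar> \<le> pi * t / 2" if "\<bar>g \<zeta> - \<tau>\<bar> \<le> pi" "cis \<tau> = cis (g q)" for \<tau>
    proof -
      have "2 / pi * \<bar>g \<zeta> - \<tau>\<bar> \<le> dist (cis (g \<zeta>)) (cis \<tau>)" using that(1) by (rule dist_cis_ge)
      also have "\<dots> = dist \<zeta> q" using that(2) pd[of "g \<zeta>" "g q"] cisg[OF \<zeta>c] cisg[OF qc] by simp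
      finally have "2 / pi * \<bar>g \<zeta> - \<tau>\<bar> \<le> t" using q by simp
      then show ?thesis using pi_gt_zero by (simp add: field_simps)
    qed
    \<comment> \<open>Lift \<open>q\<close> to an angle \<open>\<tau>\<close> within
      \<open>pi\<close> of \<open>g \<zeta>\<close>. Without a shift, \<open>\<tau>\<close> avoids
      the interval because \<open>q\<close> is not in \<open>I\<close>; shifted by
      \<open>2*pi\<close> or \<open>-2*pi\<close>, it leaves \<open>[0, 2*pi)\<close>, and so lies
      beyond \<open>b\<close> or before \<open>a\<close>.\<close>
    have "\<exists>\<tau>. \<bar>g \<zeta> - \<tau>\<bar> \<le> pi * t / 2 \<and> (\<tau> \<le> a \<or> b \<le> \<tau>)"
    proof -
      consider "\<bar>g \<zeta> - g q\<bar> \<le> pi" | "\<bar>g \<zeta> - (g q + 2 * pi)\<bar> \<le> pi" | "\<bar>g \<zeta> - (g q - 2 * pi)\<bar> \<le> pi"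
        using g[of \<zeta>] g[of q] by linarith
      then show ?thesis
      proof cases
        case 1
        then show ?thesis using close[OF 1] outside[OF qI] by auto
      next
        case 2
        have "cis (g q + 2 * pi) = cis (g q)" by (simp add: complex_eq_iff)
        from close[OF 2 this] show ?thesis using b2 g[of q] by (intro exI[of _ "g q + 2 * pi"]) auto
      next
        case 3
        have "cis (g q - 2 * pi) = cis (g q)" by (simp add: complex_eq_iff cos_diff sin_diff)
        from close[OF 3 this] show ?thesis using a0 g[of q] by (intro exI[of _ "g q - 2 * pi"]) auto
      qed
    qed
    then have "\<bar>a - g \<zeta>\<bar> \<le> pi * t / 2 \<or> \<bar>b - g \<zeta>\<bar> \<le> pi * t / 2"
      using ab[OF \<zeta>(1)] by (auto simp: abs_le_iff)
    moreover have "\<zeta> \<in> ?B x" if "\<bar>x - g \<zeta>\<bar> \<le> pi * t / 2" for x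
      using order_trans[OF dist_cis_le that] pd[of x "g \<zeta>"] cisg[OF \<zeta>c] \<zeta>c by simp
    ultimately show "\<zeta> \<in> ?B a \<union> ?B b" by blast
  qed
  then have "emeasure circle_measure (I \<inter> {\<zeta>. infdist \<zeta> E < t}) \<le> emeasure circle_measure (?B a \<union> ?B b)"
    by (intro emeasure_mono sets.Un \<sigma>.sets_M_I) auto
  also have "\<dots> \<le> emeasure circle_measure (?B a) + emeasure circle_measure (?B b)"
    by (intro emeasure_subadditive \<sigma>.sets_M_I) auto
  also have "\<dots> \<le> ennreal (2 * (pi * t / 2)) + ennreal (2 * (pi * t / 2))"
    using np t by (intro add_mono circle_measure_cball_le) (auto simp: norm_mult)
  also have "\<dots> = ennreal (2 * pi * t)" using t by (simp flip: ennreal_plus)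
  finally show ?thesis .
qed

text \<open>Countable subadditivity for an unordered sum, obtained from finite unions by continuity
  from below.\<close>

lemma emeasure_countable_UN_le_infsum:
  assumes C: "countable C" and X: "\<And>i. i \<in> C \<Longrightarrow> X i \<in> sets N"
  shows "emeasure N (\<Union>i\<in>C. X i) \<le> (\<Sum>\<^sub>\<infinity>i\<in>C. emeasure N (X i))"
proof (cases "C = {}")
  case False
  define f where "f = from_nat_into C"
  have ran: "range f = C" unfolding f_def using False C by (rule range_from_nat_into)
  have fX: "X (f n) \<in> sets N" for n using X ran by blast
  have "(\<Union>i\<in>C. X i) = (\<Union>n. \<Union>k<n. X (f k))" unfolding ran[symmetric] by auto
  also have "emeasure N \<dots> = (SUP n. emeasure N (\<Union>k<n. X (f k)))"
    using fX by (intro SUP_emeasure_incseq[symmetric]) (auto simp: incseq_def intro: less_le_trans)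
  also have "\<dots> \<le> (\<Sum>\<^sub>\<infinity>i\<in>C. emeasure N (X i))"
  proof (rule SUP_least)
    fix n
    \<comment> \<open>The enumeration may repeat indices, as it must when \<open>C\<close> is
      finite; passing to its image counts each index once.\<close>
    have "(\<Union>k<n. X (f k)) = (\<Union>i\<in>f ` {..<n}. X i)" by auto
    also have "emeasure N \<dots> \<le> (\<Sum>i\<in>f ` {..<n}. emeasure N (X i))"
      using fX by (intro emeasure_subadditive_finite) auto
    also have "\<dots> \<le> (\<Sum>\<^sub>\<infinity>i\<in>C. emeasure N (X i))"
      using ran by (subst nonneg_infsum_complete) (auto intro!: SUP_upper)
    finally show "emeasure N (\<Union>k<n. X (f k)) \<le> (\<Sum>\<^sub>\<infinity>i\<in>C. emeasure N (X i))" .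
  qed
  finally show ?thesis .
qed simp

text \<open>As \<open>E\<close> is null, only the gaps count. A gap contributes at most its own
  length, and at most \<open>6 * pi * t\<close> by the preceding estimate; the common form with
  \<open>min\<close> is the one that integrating \<open>gap_counting\<close> produces.\<close>

lemma emeasure_set_neighbourhood_le:
  assumes E: "E \<subseteq> circle" "E \<noteq> {}" "closed E" and null: "emeasure circle_measure E = 0" and t: "t > 0"
  shows "emeasure circle_measure (circle \<inter> {\<zeta>. infdist \<zeta> E < 3 * t})
    \<le> (\<Sum>\<^sub>\<infinity>I\<in>components (circle - E). ennreal (3 * pi * min (arc_length I) (2 * t)))"
proof -
  interpret \<sigma>: finite_circle_measure circle_measure by (rule finite_circle_measure_circle_measure)
  let ?C = "components (circle - E)" and ?N = "{\<zeta>. infdist \<zeta> E < 3 * t}"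
  have m: "I \<inter> ?N \<in> sets circle_measure" if "I \<in> ?C" for I
  proof -
    have "I \<inter> ?N = circle \<inter> (I \<inter> ?N)" using in_components_subset[OF that] by auto
    also have "\<dots> \<in> sets circle_measure"
      using gap_borel[OF E(3) that] by (intro \<sigma>.sets_M_I sets.Int) auto
    finally show ?thesis .
  qed
  have mE: "E \<in> sets circle_measure" using \<sigma>.sets_M_I[of E] E by (simp add: Int_absorb1)
  have mU: "(\<Union>I\<in>?C. I \<inter> ?N) \<in> sets circle_measure"
    using m countable_gaps[OF E(3)] by (intro sets.countable_UN') auto
  have "circle \<inter> ?N \<subseteq> E \<union> (\<Union>I\<in>?C. I \<inter> ?N)"
    using Union_components[of "circle - E"] by blast
  then have "emeasure circle_measure (circle \<inter> ?N) \<le> emeasure circle_measure (E \<union> (\<Union>I\<in>?C. I \<inter> ?N))"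
    using mE mU by (intro emeasure_mono) auto
  also have "\<dots> \<le> emeasure circle_measure E + emeasure circle_measure (\<Union>I\<in>?C. I \<inter> ?N)"
    using mE mU by (rule emeasure_subadditive)
  also have "\<dots> \<le> (\<Sum>\<^sub>\<infinity>I\<in>?C. emeasure circle_measure (I \<inter> ?N))"
    unfolding null add_0 using emeasure_countable_UN_le_infsum[OF countable_gaps[OF E(3)] m] .
  also have "\<dots> \<le> (\<Sum>\<^sub>\<infinity>I\<in>?C. ennreal (3 * pi * min (arc_length I) (2 * t)))"
  proof (rule infsum_mono)
    fix I assume I: "I \<in> ?C"
    have "emeasure circle_measure (I \<inter> ?N) \<le> emeasure circle_measure I"
    proof (rule emeasure_mono)
      have "circle \<inter> I = I" using in_components_subset[OF I] by blast
      then show "I \<in> sets circle_measure" using \<sigma>.sets_M_I[OF gap_borel[OF E(3) I]] by simp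
    qed blast
    also have "\<dots> = ennreal (arc_length I / (2 * pi))"
      by (simp add: arc_length_def \<sigma>.emeasure_eq_measure)
    also have "\<dots> \<le> ennreal (3 * pi * arc_length I)"
    proof (rule ennreal_leI)
      have "arc_length I / (2 * pi) \<le> arc_length I / 1"
        using pi_gt3 by (intro divide_left_mono) (auto simp: arc_length_def)
      also have "\<dots> \<le> 3 * pi * arc_length I"
        using pi_gt3 mult_right_mono[of 1 "3 * pi" "arc_length I"] by (simp add: arc_length_def)
      finally show "arc_length I / (2 * pi) \<le> 3 * pi * arc_length I" .
    qed
    finally have 1: "emeasure circle_measure (I \<inter> ?N) \<le> ennreal (3 * pi * arc_length I)" .
    have "emeasure circle_measure (I \<inter> ?N) \<le> ennreal (2 * pi * (3 * t))"
      using E I t by (intro emeasure_gap_neighbourhood_le) auto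
    then have 2: "emeasure circle_measure (I \<inter> ?N) \<le> ennreal (3 * pi * (2 * t))"
      by (simp add: mult_ac)
    from 1 2 show "emeasure circle_measure (I \<inter> ?N) \<le> ennreal (3 * pi * min (arc_length I) (2 * t))"
      by (cases "arc_length I \<le> 2 * t") (auto simp: min_def)
  qed (rule nonneg_summable_on_complete, simp)+
  finally show ?thesis .
qed

text \<open>Layer-cake formula: a gap is counted exactly for \<open>s < arc_length I / 2\<close>.
  Finite families suffice, since the sum over all gaps is a supremum over them.\<close>

lemma nn_integral_gap_indicators:
  assumes F: "finite F" and t: "t > 0"
  shows "(\<integral>\<^sup>+s\<in>{0<..<t}. 2 * (\<Sum>I\<in>F. indicator {J. arc_length J > 2 * s} I) \<partial>lborel)
    = (\<Sum>I\<in>F. ennreal (min (arc_length I) (2 * t)))"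
proof -
  have "(\<integral>\<^sup>+s\<in>{0<..<t}. 2 * (\<Sum>I\<in>F. indicator {J. arc_length J > 2 * s} I) \<partial>lborel)
    = (\<integral>\<^sup>+s. (\<Sum>I\<in>F. 2 * indicator {0<..<min t (arc_length I / 2)} s) \<partial>lborel)"
    by (intro nn_integral_cong) (auto simp: sum_distrib_left sum_distrib_right indicator_def intro!: sum.cong)
  also have "\<dots> = (\<Sum>I\<in>F. \<integral>\<^sup>+s. 2 * indicator {0<..<min t (arc_length I / 2)} s \<partial>lborel)"
    by (rule nn_integral_sum) auto
  also have "\<dots> = (\<Sum>I\<in>F. ennreal (min (arc_length I) (2 * t)))"
  proof (rule sum.cong)
    fix I
    have "0 \<le> min t (arc_length I / 2)" using t by (simp add: arc_length_def)
    then have "(\<integral>\<^sup>+s. 2 * indicator {0<..<min t (arc_length I / 2)} s \<partial>lborel) = ennreal 2 * ennreal (min t (arc_length I / 2))"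
      by (simp add: nn_integral_cmult)
    also have "\<dots> = ennreal (2 * min t (arc_length I / 2))" by (rule ennreal_mult'[symmetric]) simp
    also have "2 * min t (arc_length I / 2) = min (arc_length I) (2 * t)" by (auto simp: min_def)
    finally show "(\<integral>\<^sup>+s. 2 * indicator {0<..<min t (arc_length I / 2)} s \<partial>lborel) = ennreal (min (arc_length I) (2 * t))" .
  qed simp
  finally show ?thesis .
qed

section \<open>Comparison with the inner integral of the hypothesis\<close>

definition gap_weight :: "complex measure \<Rightarrow> complex set \<Rightarrow> real \<Rightarrow> ennreal" where
  "gap_weight \<mu> E t =
     (\<integral>\<^sup>+ s\<in>{0<..<t}. modulus_of_continuity \<mu> s * gap_counting E s / ennreal s \<partial>lborel)"

lemma gap_weight_mono: "s \<le> t \<Longrightarrow> gap_weight \<mu> E s \<le> gap_weight \<mu> E t"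
  unfolding gap_weight_def by (intro nn_integral_mono) (auto simp: indicator_def)

context finite_circle_measure
begin

text \<open>By Jordan's inequality, a chord shorter than \<open>2 * s / pi\<close> subtends an angle
  smaller than \<open>s\<close>.\<close>

lemma ball_modulus_le_modulus_of_continuity:
  assumes "s > 0"
  shows "ball_modulus (2 * s / pi) \<le> modulus_of_continuity M s"
  unfolding ball_modulus_def
proof (rule SUP_least)
  fix \<zeta> assume \<zeta>: "\<zeta> \<in> circle"
  let ?A = "{\<zeta> * cis \<theta> | \<theta>. \<bar>\<theta>\<bar> < s}"
  have nz: "\<zeta> \<noteq> 0" "cmod \<zeta> = 1" using \<zeta> by auto
  have d: "dist \<zeta> (\<zeta> * cis \<theta>) = dist (cis 0) (cis \<theta>)" for \<theta>
  proof -
    have "\<zeta> - \<zeta> * cis \<theta> = \<zeta> * (1 - cis \<theta>)" by (simp add: algebra_simps)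
    then show ?thesis using nz by (simp add: dist_norm norm_mult)
  qed
  have "circle \<inter> ball \<zeta> (2 * s / pi) \<subseteq> ?A"
  proof
    fix \<xi> assume \<xi>: "\<xi> \<in> circle \<inter> ball \<zeta> (2 * s / pi)"
    then have "\<xi> / \<zeta> \<in> circle" using \<zeta> by (simp add: norm_divide)
    then obtain \<theta> where \<theta>: "-pi \<le> \<theta>" "\<theta> < pi" "\<xi> / \<zeta> = cis \<theta>" by (rule circle_eq_cis)
    then have eq: "\<xi> = \<zeta> * cis \<theta>" using nz by (simp add: field_simps)
    have "2 / pi * \<bar>0 - \<theta>\<bar> \<le> dist (cis 0) (cis \<theta>)" using \<theta> by (intro dist_cis_ge) auto
    also have "\<dots> < 2 * s / pi" using \<xi> d[of \<theta>] eq by simp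
    finally have "\<bar>\<theta>\<bar> < s" by (simp add: field_simps)
    then show "\<xi> \<in> ?A" using eq by blast
  qed
  moreover have "?A \<in> sets M"
  proof -
    \<comment> \<open>Monotonicity of \<open>emeasure\<close> requires the open arc to be
      measurable; it is exhausted by compact arcs.\<close>
    have "?A = (\<Union>n. (\<lambda>\<theta>. \<zeta> * cis \<theta>) ` {- (s - s / Suc n) .. s - s / Suc n})"
    proof (intro set_eqI iffI)
      fix z assume "z \<in> ?A"
      then obtain \<theta> where \<theta>: "z = \<zeta> * cis \<theta>" "\<bar>\<theta>\<bar> < s" by auto
      obtain n where n: "inverse (real (Suc n)) < (s - \<bar>\<theta>\<bar>) / s"
        using reals_Archimedean[of "(s - \<bar>\<theta>\<bar>) / s"] \<theta> assms by auto
      then have "s / Suc n < s - \<bar>\<theta>\<bar>" using assms by (simp add: field_simps)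
      then have "\<theta> \<in> {- (s - s / Suc n) .. s - s / Suc n}" by (auto simp: abs_le_iff)
      then show "z \<in> (\<Union>n. (\<lambda>\<theta>. \<zeta> * cis \<theta>) ` {- (s - s / Suc n) .. s - s / Suc n})" using \<theta> by blast
    next
      fix z assume "z \<in> (\<Union>n. (\<lambda>\<theta>. \<zeta> * cis \<theta>) ` {- (s - s / Suc n) .. s - s / Suc n})"
      then obtain n \<theta> where \<theta>: "z = \<zeta> * cis \<theta>" "\<theta> \<in> {- (s - s / Suc n) .. s - s / Suc n}"
        by (elim UN_E imageE) blast
      have "s / Suc n > 0" using assms by simp
      then have "\<bar>\<theta>\<bar> < s" using \<theta>(2) unfolding atLeastAtMost_iff by linarith
      then show "z \<in> ?A" using \<theta>(1) by blast
    qed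
    also have "\<dots> \<in> sets borel"
      by (intro sets.countable_UN'' borel_closed compact_imp_closed compact_continuous_image continuous_intros) auto
    finally have "circle \<inter> ?A \<in> sets M" by (rule sets_M_I)
    moreover have "circle \<inter> ?A = ?A" using nz by (auto simp: norm_mult)
    ultimately show ?thesis by simp
  qed
  ultimately have "emeasure M (circle \<inter> ball \<zeta> (2 * s / pi)) \<le> emeasure M ?A" by (rule emeasure_mono)
  also have "\<dots> \<le> modulus_of_continuity M s"
    unfolding modulus_of_continuity_def using \<zeta> by (rule SUP_upper)
  finally show "emeasure M (circle \<inter> ball \<zeta> (2 * s / pi)) \<le> modulus_of_continuity M s" .
qed

text \<open>The growth estimate from the radius \<open>2 * s / pi\<close> up to \<open>t\<close>.
  Read backwards, it bounds the quotient of \<open>modulus_of_continuity M s\<close> by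
  \<open>s\<close> from below, uniformly for \<open>0 < s < t\<close>.\<close>

lemma ball_modulus_doubling:
  assumes "0 < s" "s \<le> t" "t \<le> 1"
  shows "ball_modulus t \<le> modulus_of_continuity M s * ennreal (4 * pi\<^sup>2 * t / s)"
  unfolding ball_modulus_def[of t]
proof (rule SUP_least)
  fix \<zeta> assume \<zeta>: "\<zeta> \<in> circle"
  have "2 * s / pi \<le> s" using assms pi_gt3 by (simp add: field_simps)
  then have le: "2 * s / pi \<le> t" "2 * s / pi \<le> pi" using assms pi_gt3 by linarith+
  have "emeasure M (circle \<inter> ball \<zeta> t) \<le> emeasure M (circle \<inter> cball \<zeta> t)"
    by (intro emeasure_mono sets_M_I) auto
  also have "\<dots> \<le> ball_modulus (2 * s / pi) * ennreal (8 * pi * t / (2 * s / pi))"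
    using assms le \<zeta> by (intro emeasure_cball_le) auto
  also have "8 * pi * t / (2 * s / pi) = 4 * pi\<^sup>2 * t / s" using assms by (simp add: field_simps power2_eq_square)
  also have "ball_modulus (2 * s / pi) * ennreal (4 * pi\<^sup>2 * t / s) \<le> modulus_of_continuity M s * ennreal (4 * pi\<^sup>2 * t / s)"
    using assms by (intro mult_right_mono ball_modulus_le_modulus_of_continuity) auto
  finally show "emeasure M (circle \<inter> ball \<zeta> t) \<le> modulus_of_continuity M s * ennreal (4 * pi\<^sup>2 * t / s)" .
qed

text \<open>Insert that uniform lower bound into \<open>gap_weight\<close>, keep only the gaps in
  \<open>F\<close>, and evaluate what remains by the layer-cake formula.\<close>

lemma ball_modulus_sum_gaps_le:
  assumes F: "finite F" "F \<subseteq> components (circle - E)" and t: "0 < t" "t \<le> 1"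
  shows "ball_modulus t * (\<Sum>I\<in>F. ennreal (min (arc_length I) (2 * t))) \<le> ennreal (4 * pi\<^sup>2 * t) * gap_weight M E t"
proof -
  let ?n = "\<lambda>s. 2 * (\<Sum>I\<in>F. indicator {J. arc_length J > 2 * s} I) :: ennreal"
  let ?c = "ball_modulus t * ennreal (1 / (4 * pi\<^sup>2 * t))"
  have c: "ennreal (4 * pi\<^sup>2 * t) * ennreal (1 / (4 * pi\<^sup>2 * t)) = 1"
    using t by (simp flip: ennreal_mult'')
  have [measurable]: "(\<lambda>s. ?n s * indicator {0<..<t} s) \<in> borel_measurable lborel"
  proof -
    have "(\<lambda>s. indicator {J. arc_length J > 2 * s} I :: ennreal) = indicator {s. 2 * s < arc_length I}" for I
      by (auto simp: indicator_def)
    then have "(\<lambda>s. indicator {J. arc_length J > 2 * s} I :: ennreal) \<in> borel_measurable borel" for I by simp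
    then show ?thesis by measurable
  qed
  have "?c * (\<integral>\<^sup>+s\<in>{0<..<t}. ?n s \<partial>lborel) = (\<integral>\<^sup>+s. ?c * (?n s * indicator {0<..<t} s) \<partial>lborel)"
    by (rule nn_integral_cmult[symmetric]) measurable
  also have "\<dots> \<le> gap_weight M E t"
    unfolding gap_weight_def
  proof (rule nn_integral_mono)
    fix s :: real
    show "?c * (?n s * indicator {0<..<t} s) \<le> modulus_of_continuity M s * gap_counting E s / ennreal s * indicator {0<..<t} s"
    proof (cases "s \<in> {0<..<t}")
      case True
      have "?c \<le> modulus_of_continuity M s * ennreal (4 * pi\<^sup>2 * t / s) * ennreal (1 / (4 * pi\<^sup>2 * t))"
        using True t by (intro mult_right_mono ball_modulus_doubling) auto
      also have "\<dots> = modulus_of_continuity M s * ennreal (1 / s)"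
        unfolding mult.assoc using True t by (subst ennreal_mult[symmetric]) auto
      finally have 1: "?c \<le> modulus_of_continuity M s * ennreal (1 / s)" .
      have "?n s \<le> gap_counting E s"
        unfolding gap_counting_def using F
        by (intro mult_left_mono) (auto simp: nonneg_infsum_complete intro!: SUP_upper)
      with 1 have "?c * ?n s \<le> modulus_of_continuity M s * ennreal (1 / s) * gap_counting E s"
        by (rule mult_mono) auto
      also have "\<dots> = modulus_of_continuity M s * gap_counting E s / ennreal s"
        using True by (simp add: divide_ennreal_def inverse_ennreal inverse_eq_divide mult_ac)
      finally show ?thesis using True by simp
    qed simp
  qed
  finally have "ennreal (4 * pi\<^sup>2 * t) * (?c * (\<integral>\<^sup>+s\<in>{0<..<t}. ?n s \<partial>lborel)) \<le> ennreal (4 * pi\<^sup>2 * t) * gap_weight M E t"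
    by (rule mult_left_mono) simp
  also have "ennreal (4 * pi\<^sup>2 * t) * (?c * (\<integral>\<^sup>+s\<in>{0<..<t}. ?n s \<partial>lborel))
     = (ennreal (4 * pi\<^sup>2 * t) * ennreal (1 / (4 * pi\<^sup>2 * t))) * (ball_modulus t * (\<integral>\<^sup>+s\<in>{0<..<t}. ?n s \<partial>lborel))"
    by (simp only: mult_ac)
  finally show ?thesis unfolding c nn_integral_gap_indicators[OF F(1) t(1)] by simp
qed

text \<open>The sum over all gaps is the supremum over finite families, and multiplication commutes
  with it. The constant is \<open>3 * pi\<close> times \<open>4 * pi\<^sup>2\<close>.\<close>

lemma ball_modulus_neighbourhood_le:
  assumes E: "E \<subseteq> circle" "E \<noteq> {}" "closed E" and null: "emeasure circle_measure E = 0"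
    and t: "0 < t" "t \<le> 1"
  shows "ball_modulus t * emeasure circle_measure (circle \<inter> {\<zeta>. infdist \<zeta> E < 3 * t})
    \<le> ennreal (12 * pi ^ 3 * t) * gap_weight M E t"
proof -
  let ?C = "components (circle - E)"
  have nn: "0 \<le> min (arc_length I) (2 * t)" for I using t by (simp add: arc_length_def)
  have "ball_modulus t * emeasure circle_measure (circle \<inter> {\<zeta>. infdist \<zeta> E < 3 * t})
    \<le> ball_modulus t * (\<Sum>\<^sub>\<infinity>I\<in>?C. ennreal (3 * pi * min (arc_length I) (2 * t)))"
    using assms by (intro mult_left_mono emeasure_set_neighbourhood_le) auto
  also have "\<dots> = (SUP F\<in>{F. finite F \<and> F \<subseteq> ?C}. ball_modulus t * (\<Sum>I\<in>F. ennreal (3 * pi * min (arc_length I) (2 * t))))"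
    by (simp add: nonneg_infsum_complete SUP_mult_left_ennreal)
  also have "\<dots> \<le> ennreal (12 * pi ^ 3 * t) * gap_weight M E t"
  proof (rule SUP_least)
    fix F assume "F \<in> {F. finite F \<and> F \<subseteq> ?C}"
    then have F: "finite F" "F \<subseteq> ?C" by auto
    have "(\<Sum>I\<in>F. ennreal (3 * pi * min (arc_length I) (2 * t))) = ennreal (3 * pi) * (\<Sum>I\<in>F. ennreal (min (arc_length I) (2 * t)))"
      by (subst sum_distrib_left) (intro sum.cong refl ennreal_mult nn; simp)
    then have "ball_modulus t * (\<Sum>I\<in>F. ennreal (3 * pi * min (arc_length I) (2 * t)))
       = ennreal (3 * pi) * (ball_modulus t * (\<Sum>I\<in>F. ennreal (min (arc_length I) (2 * t))))"
      by (simp only: mult.left_commute)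
    also have "\<dots> \<le> ennreal (3 * pi) * (ennreal (4 * pi\<^sup>2 * t) * gap_weight M E t)"
      using F t by (intro mult_left_mono ball_modulus_sum_gaps_le) auto
    also have "\<dots> = ennreal (12 * pi ^ 3 * t) * gap_weight M E t"
      using t by (simp add: mult.assoc[symmetric] ennreal_mult'[symmetric] power3_eq_cube power2_eq_square)
    finally show "ball_modulus t * (\<Sum>I\<in>F. ennreal (3 * pi * min (arc_length I) (2 * t))) \<le> ennreal (12 * pi ^ 3 * t) * gap_weight M E t" .
  qed
  finally show ?thesis .
qed

end

section \<open>Choice of the weights and conclusion\<close>

text \<open>Under the constraint that the weights sum to 1, the quadratic form is smallest for
  \<open>c k\<close> proportional to \<open>1 / B k\<close>, and its value is then the reciprocal of
  the sum of the \<open>1 / B k\<close>, which divergence makes as small as desired.\<close>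

lemma weights_of_divergent_series:
  fixes B :: "nat \<Rightarrow> ennreal"
  assumes div: "(\<Sum>i. 1 / B (k0 + i)) = \<infinity>" and e: "e > 0"
  obtains m c where "\<And>k. 0 \<le> c k" "(\<Sum>k=k0..m. c k) = 1"
    "(\<Sum>k=k0..m. ennreal ((c k)\<^sup>2) * B k) \<le> ennreal e"
\<comment> \<open>If some \<open>B k\<close> vanishes, all the weight goes to that index. Otherwise
  every \<open>1 / B k\<close> is finite and can be handled as a real number.\<close>
proof (cases "\<exists>k\<ge>k0. B k = 0")
  case True
  then obtain j where j: "j \<ge> k0" "B j = 0" by blast
  define c where "c k = (if k = j then 1 else 0 :: real)" for k
  show ?thesis
  proof (rule that[of c j])
    show "(\<Sum>k=k0..j. c k) = 1" using j by (simp add: c_def)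
    have "(\<Sum>k=k0..j. ennreal ((c k)\<^sup>2) * B k) = 0" using j by (intro sum.neutral) (auto simp: c_def)
    also have "0 \<le> ennreal e" by simp
    finally show "(\<Sum>k=k0..j. ennreal ((c k)\<^sup>2) * B k) \<le> ennreal e" .
  qed (simp add: c_def)
next
  case False
  define x where "x k = enn2real (1 / B k)" for k
  have x0: "0 \<le> x k" for k by (simp add: x_def)
  have x: "ennreal (x k) = 1 / B k" if "k \<ge> k0" for k
    unfolding x_def using False that
    by (intro ennreal_enn2real) (auto simp: divide_ennreal_def less_top[symmetric])
  have "\<exists>n. (\<Sum>i<n. x (k0 + i)) \<ge> 1 / e"
  proof (rule ccontr)
    assume "\<not> ?thesis"
    then have le: "(\<Sum>i<n. x (k0 + i)) \<le> 1 / e" for n by (meson not_le less_imp_le)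
    have "(\<Sum>i. 1 / B (k0 + i)) \<le> ennreal (1 / e)"
    proof (rule suminf_le_const[OF summableI])
      fix n
      have "(\<Sum>i<n. 1 / B (k0 + i)) = (\<Sum>i<n. ennreal (x (k0 + i)))" by (simp add: x)
      also have "\<dots> = ennreal (\<Sum>i<n. x (k0 + i))" using x0 by simp
      finally show "(\<Sum>i<n. 1 / B (k0 + i)) \<le> ennreal (1 / e)" using le by (simp add: ennreal_leI)
    qed
    then have "(\<Sum>i. 1 / B (k0 + i)) < \<infinity>" by (rule le_less_trans) simp
    then show False using div by simp
  qed
  then obtain n where n: "(\<Sum>i<n. x (k0 + i)) \<ge> 1 / e" by blast
  \<comment> \<open>The range \<open>{k0..m}\<close> has one term more than the partial sum, which
    can only increase \<open>X\<close>.\<close>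
  define m where "m = k0 + n"
  define X where "X = (\<Sum>k=k0..m. x k)"
  have "(\<Sum>i<n. x (k0 + i)) = (\<Sum>k\<in>(\<lambda>i. k0 + i) ` {..<n}. x k)"
    by (simp add: sum.reindex)
  also have "\<dots> \<le> X" unfolding X_def using x0 by (intro sum_mono2) (auto simp: m_def)
  finally have X: "1 / e \<le> X" using n by simp
  then have X0: "X > 0" using e by (meson divide_pos_pos less_le_trans zero_less_one)
  define c where "c k = x k / X" for k
  show ?thesis
  proof (rule that[of c m])
    show "0 \<le> c k" for k using x0 X0 by (simp add: c_def)
    show "(\<Sum>k=k0..m. c k) = 1" using X0 by (simp add: c_def X_def flip: sum_divide_distrib)
    have "ennreal ((c k)\<^sup>2) * B k = ennreal (x k / X\<^sup>2)" if "k \<in> {k0..m}" for k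
    proof (cases "B k")
      case (real b)
      have "b \<noteq> 0" using False that real by auto
      then have b: "b > 0" using real by simp
      then have "ennreal (x k) = ennreal (1 / b)" using x[of k] that real
        by (simp add: divide_ennreal flip: ennreal_1)
      then have "x k = 1 / b" using x0 b by simp
      then have "(c k)\<^sup>2 * b = x k / X\<^sup>2" using b by (simp add: c_def field_simps power2_eq_square)
      then show ?thesis using real by (simp flip: ennreal_mult')
    next
      case top
      \<comment> \<open>Where \<open>B k\<close> is infinite the weight is 0, and
        \<open>0 * \<infinity> = 0\<close>.\<close>
      then have "x k = 0" by (simp add: x_def)
      then show ?thesis by (simp add: c_def)
    qed
    then have "(\<Sum>k=k0..m. ennreal ((c k)\<^sup>2) * B k) = (\<Sum>k=k0..m. ennreal (x k / X\<^sup>2))" by simp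
    also have "\<dots> = ennreal (X / X\<^sup>2)" using x0 by (simp add: X_def sum_divide_distrib)
    also have "X / X\<^sup>2 = 1 / X" using X0 by (simp add: power2_eq_square)
    also have "ennreal (1 / X) \<le> ennreal e" using X X0 e by (intro ennreal_leI) (simp add: field_simps)
    finally show "(\<Sum>k=k0..m. ennreal ((c k)\<^sup>2) * B k) \<le> ennreal e" .
  qed
qed

section \<open>From the divergent integral to a divergent series\<close>

lemma ennreal_suminf_Suc_le:
  fixes f :: "nat \<Rightarrow> ennreal"
  shows "(\<Sum>i. f (Suc i)) \<le> (\<Sum>i. f i)"
proof (rule suminf_le_const[OF summableI])
  fix n
  have "(\<Sum>i<n. f (Suc i)) = sum f (Suc ` {..<n})" by (simp add: sum.reindex)
  also have "\<dots> \<le> (\<Sum>i. f i)" by (intro sum_le_suminf summableI) auto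
  finally show "(\<Sum>i<n. f (Suc i)) \<le> (\<Sum>i. f i)" .
qed

lemma ennreal_inverse_antimono:
  fixes a b :: ennreal
  shows "a \<le> b \<Longrightarrow> inverse b \<le> inverse a"
  unfolding less_eq_ennreal.rep_eq inverse_ennreal.rep_eq
  by (rule ereal_inverse_antimono[OF enn2ereal_nonneg])

text \<open>Cauchy condensation. \<open>1 / W\<close> is decreasing, so on the interval from
  \<open>1 / 4 ^ (k0 + i + 1)\<close> to \<open>1 / 4 ^ (k0 + i)\<close> it is at most its value at
  the left end, and the length is 3 times that end point. The part of the integral beyond
  \<open>1 / 4 ^ k0\<close> is finite, so the divergence comes from the tail at 0.\<close>

lemma condensation_divergent:
  fixes W :: "real \<Rightarrow> ennreal"
  assumes mono: "\<And>s t. s \<le> t \<Longrightarrow> W s \<le> W t"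
    and div: "(\<integral>\<^sup>+t\<in>{0<..<pi}. 1 / W t \<partial>lborel) = \<infinity>"
  shows "(\<Sum>i. 1 / (W (1 / 4 ^ (k0 + i)) * ennreal (4 ^ (k0 + i)))) = \<infinity>"
\<comment> \<open>In this case the first term of the series is already infinite. Otherwise
  \<open>1 / W\<close> is bounded on \<open>[1 / 4 ^ k0, pi)\<close>.\<close>
proof (cases "W (1 / 4 ^ k0) = 0")
  case True
  then show ?thesis
    using ennreal_le_suminf[of "\<lambda>i. 1 / (W (1 / 4 ^ (k0 + i)) * ennreal (4 ^ (k0 + i)))" 0]
    by (simp add: top_unique)
next
  case False
  let ?t = "\<lambda>i. 1 / 4 ^ (k0 + i) :: real"
  let ?S = "\<Sum>i. 1 / (W (?t i) * ennreal (4 ^ (k0 + i)))"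
  have anti: "1 / W t \<le> 1 / W s" if "s \<le> t" for s t
    unfolding divide_ennreal_def using mono[OF that] by (intro mult_left_mono ennreal_inverse_antimono) auto
  have step: "1 / W t * indicator {0<..<pi} t \<le>
      (\<Sum>i. 1 / W (?t (Suc i)) * indicator {?t (Suc i)..?t i} t) + 1 / W (?t 0) * indicator {0<..<pi} t" for t
  proof (cases "t \<in> {0<..<pi}")
    case t: True
    show ?thesis
    proof (cases "t < ?t 0")
      case True
      obtain n where "1 / t < 4 ^ n" using real_arch_pow[of 4 "1/t"] by auto
      also have "(4::real) ^ n \<le> 4 ^ (k0 + Suc n)" by (rule power_increasing) auto
      finally have ex: "?t (Suc n) < t" using t by (simp add: field_simps)
      define j where "j = (LEAST j. ?t (Suc j) < t)"
      have j1: "?t (Suc j) < t" unfolding j_def by (rule LeastI[of _ n]) (rule ex)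
      have j2: "t \<le> ?t j"
      proof (cases j)
        case 0 then show ?thesis using True by simp
      next
        case (Suc i)
        then have "\<not> ?t (Suc i) < t" using not_less_Least[of i "\<lambda>j. ?t (Suc j) < t"] by (simp add: j_def)
        then show ?thesis using Suc by simp
      qed
      have "1 / W t * indicator {0<..<pi} t \<le> 1 / W (?t (Suc j)) * indicator {?t (Suc j)..?t j} t"
        using anti[of "?t (Suc j)" t] j1 j2 t by simp
      also have "\<dots> \<le> (\<Sum>i. 1 / W (?t (Suc i)) * indicator {?t (Suc i)..?t i} t)"
        by (rule ennreal_le_suminf)
      finally show ?thesis by (rule order_trans) simp
    next
      case False
      then show ?thesis using anti[of "?t 0" t] t by (intro add_increasing) auto
    qed
  qed simp
  have "\<infinity> \<le> (\<integral>\<^sup>+t. (\<Sum>i. 1 / W (?t (Suc i)) * indicator {?t (Suc i)..?t i} t) + 1 / W (?t 0) * indicator {0<..<pi} t \<partial>lborel)"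
    unfolding div[symmetric] by (intro nn_integral_mono step)
  also have "\<dots> = (\<Sum>i. 1 / W (?t (Suc i)) * emeasure lborel {?t (Suc i)..?t i}) + 1 / W (?t 0) * emeasure lborel {0<..<pi}"
    by (subst nn_integral_add) (auto simp: nn_integral_suminf nn_integral_cmult)
  also have "(\<Sum>i. 1 / W (?t (Suc i)) * emeasure lborel {?t (Suc i)..?t i}) \<le> 3 * ?S"
  proof -
    have *: "1 / W (?t (Suc i)) * emeasure lborel {?t (Suc i)..?t i}
       = 3 * (1 / (W (?t (Suc i)) * ennreal (4 ^ (k0 + Suc i))))" for i
    proof -
      have "emeasure lborel {?t (Suc i)..?t i} = ennreal (3 * inverse (4 ^ (k0 + Suc i)))"
        by (subst emeasure_lborel_Icc) (auto simp: field_simps)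
      also have "\<dots> = 3 * inverse (ennreal (4 ^ (k0 + Suc i)))"
        by (subst inverse_ennreal, simp, subst ennreal_mult, simp, simp, simp only: ennreal_numeral)
      finally show ?thesis
        by (simp add: divide_ennreal_def ennreal_inverse_mult' mult_ac)
    qed
    have "(\<Sum>i. 1 / W (?t (Suc i)) * emeasure lborel {?t (Suc i)..?t i})
       = 3 * (\<Sum>i. 1 / (W (?t (Suc i)) * ennreal (4 ^ (k0 + Suc i))))"
      unfolding * by (rule ennreal_suminf_cmult)
    also have "(\<Sum>i. 1 / (W (?t (Suc i)) * ennreal (4 ^ (k0 + Suc i)))) \<le> ?S"
      by (rule ennreal_suminf_Suc_le)
    finally show ?thesis by (simp add: mult_left_mono)
  qed
  finally have top: "3 * ?S + 1 / W (?t 0) * emeasure lborel {0<..<pi} = \<infinity>"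
    by (simp add: top_unique add_right_mono)
  have "1 / W (?t 0) * emeasure lborel {0<..<pi} \<noteq> \<infinity>"
    using False by (auto simp: ennreal_mult_eq_top_iff divide_ennreal_def)
  then show ?thesis using top by (auto simp: ennreal_mult_eq_top_iff)
qed

text \<open>Continuity from above: the neighbourhoods shrink to \<open>E\<close> because
  \<open>E\<close> is closed. This makes the \<open>L\<^sup>2\<close> part of the norm
  small.\<close>

lemma emeasure_neighbourhoods_tendsto_0:
  assumes E: "closed E" "E \<noteq> {}" "E \<subseteq> circle" and null: "emeasure circle_measure E = 0"
  shows "(\<lambda>n. emeasure circle_measure (circle \<inter> {\<zeta>. infdist \<zeta> E < 1 / 4 ^ n})) \<longlonglongrightarrow> 0"
proof -
  interpret \<sigma>: finite_circle_measure circle_measure by (rule finite_circle_measure_circle_measure)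
  let ?A = "\<lambda>n::nat. circle \<inter> {\<zeta>. infdist \<zeta> E < 1 / 4 ^ n}"
  have "(\<lambda>n. emeasure circle_measure (?A n)) \<longlonglongrightarrow> emeasure circle_measure (\<Inter>n. ?A n)"
  proof (rule Lim_emeasure_decseq)
    show "range ?A \<subseteq> sets circle_measure" by (auto intro!: \<sigma>.sets_M_I)
    show "decseq ?A"
    proof (rule antimonoI)
      fix m n :: nat assume "m \<le> n"
      then have "1 / 4 ^ n \<le> (1 / 4 ^ m :: real)" by (intro divide_left_mono power_increasing) auto
      then show "?A n \<subseteq> ?A m" by auto
    qed
  qed simp
  also have "(\<Inter>n. ?A n) = E"
  proof (intro equalityI subsetI)
    fix \<zeta> assume \<zeta>: "\<zeta> \<in> (\<Inter>n. ?A n)"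
    have "infdist \<zeta> E \<le> 0"
    proof (rule ccontr)
      assume "\<not> ?thesis"
      then have pos: "infdist \<zeta> E > 0" by simp
      obtain n where "1 / infdist \<zeta> E < 4 ^ n" using real_arch_pow[of 4 "1 / infdist \<zeta> E"] by auto
      then have "1 / 4 ^ n < infdist \<zeta> E" using pos by (simp add: field_simps)
      moreover have "infdist \<zeta> E < 1 / 4 ^ n" using \<zeta> by auto
      ultimately show False by simp
    qed
    then have "infdist \<zeta> E = 0" using infdist_nonneg[of \<zeta> E] by linarith
    then show "\<zeta> \<in> E" using E by (simp add: in_closed_iff_infdist_zero)
  qed (use E in auto)
  finally show ?thesis using null by simp
qed

section \<open>Estimate of the capacity\<close>

context finite_circle_measure
begin

text \<open>The factor \<open>t\<close> of the gap estimate cancels one of the two powers of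
  \<open>1 / t\<close> in the energy estimate, leaving \<open>4 ^ k\<close>; the constant is
  \<open>8 * 12 * 128\<close>.\<close>

lemma dirichlet_integral_test_function_le_gap_weight:
  assumes E: "E \<subseteq> circle" "E \<noteq> {}" "closed E" and null: "emeasure circle_measure E = 0"
    and K: "finite K" and c: "\<And>k. k \<in> K \<Longrightarrow> 0 \<le> c k"
  shows "dirichlet_integral M (test_function E c K)
    \<le> ennreal (12288 * pi ^ 4) * (\<Sum>k\<in>K. ennreal ((c k)\<^sup>2) * (gap_weight M E (1 / 4 ^ k) * ennreal (4 ^ k)))"
proof -
  have "dirichlet_integral M (test_function E c K)
    \<le> (\<Sum>k\<in>K. ennreal (8 * (c k)\<^sup>2) * (ball_modulus (1 / 4 ^ k) *
          emeasure circle_measure (circle \<inter> {\<xi>. infdist \<xi> E < 3 * (1 / 4 ^ k)}) * ennreal (128 * pi / (1 / 4 ^ k)\<^sup>2)))"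
    using K c by (rule dirichlet_integral_test_function_le)
  also have "\<dots> \<le> (\<Sum>k\<in>K. ennreal (8 * (c k)\<^sup>2) * (ennreal (12 * pi ^ 3 * (1 / 4 ^ k)) * gap_weight M E (1 / 4 ^ k) * ennreal (128 * pi / (1 / 4 ^ k)\<^sup>2)))"
    using E null by (intro sum_mono mult_left_mono mult_right_mono ball_modulus_neighbourhood_le) (auto simp: divide_le_eq)
  also have "\<dots> = ennreal (12288 * pi ^ 4) * (\<Sum>k\<in>K. ennreal ((c k)\<^sup>2) * (gap_weight M E (1 / 4 ^ k) * ennreal (4 ^ k)))"
    unfolding sum_distrib_left
  proof (rule sum.cong)
    fix k
    have mult3: "ennreal x * (ennreal y * ennreal z) = ennreal (x * (y * z))"
      if "0 \<le> x" "0 \<le> y" "0 \<le> z" for x y z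
      using that by (simp add: ennreal_mult)
    have r: "8 * (c k)\<^sup>2 * (12 * pi ^ 3 * (1 / 4 ^ k) * (128 * pi / (1 / 4 ^ k)\<^sup>2))
        = 12288 * pi ^ 4 * ((c k)\<^sup>2 * 4 ^ k)"
      by (simp add: power2_eq_square power3_eq_cube power4_eq_xxxx field_simps)
    have "ennreal (8 * (c k)\<^sup>2) * (ennreal (12 * pi ^ 3 * (1 / 4 ^ k)) * gap_weight M E (1 / 4 ^ k) * ennreal (128 * pi / (1 / 4 ^ k)\<^sup>2))
      = ennreal (8 * (c k)\<^sup>2) * (ennreal (12 * pi ^ 3 * (1 / 4 ^ k)) * ennreal (128 * pi / (1 / 4 ^ k)\<^sup>2)) * gap_weight M E (1 / 4 ^ k)"
      by (simp only: mult_ac)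
    also have "ennreal (8 * (c k)\<^sup>2) * (ennreal (12 * pi ^ 3 * (1 / 4 ^ k)) * ennreal (128 * pi / (1 / 4 ^ k)\<^sup>2))
      = ennreal (12288 * pi ^ 4 * ((c k)\<^sup>2 * 4 ^ k))"
      unfolding r[symmetric] by (rule mult3) auto
    also have "\<dots> = ennreal (12288 * pi ^ 4) * (ennreal ((c k)\<^sup>2) * ennreal (4 ^ k))"
      by (rule mult3[symmetric]) auto
    finally show "ennreal (8 * (c k)\<^sup>2) * (ennreal (12 * pi ^ 3 * (1 / 4 ^ k)) * gap_weight M E (1 / 4 ^ k) * ennreal (128 * pi / (1 / 4 ^ k)\<^sup>2))
      = ennreal (12288 * pi ^ 4) * (ennreal ((c k)\<^sup>2) * (gap_weight M E (1 / 4 ^ k) * ennreal (4 ^ k)))"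
      by (simp only: mult_ac)
  qed simp
  finally show ?thesis .
qed

text \<open>The test function takes values in \<open>[0, 1]\<close>, vanishes outside the
  neighbourhood given by the coarsest scale \<open>k0\<close>, and equals 1 on the one given by the
  finest scale \<open>m\<close>. The former bounds its \<open>L\<^sup>2\<close> norm, the latter
  makes it admissible.\<close>

lemma capacity_le_test_function:
  assumes c: "\<And>k. 0 \<le> c k" and c1: "(\<Sum>k=k0..m. c k) = 1"
    and fin: "dirichlet_integral M (test_function E c {k0..m}) < \<infinity>" and E: "E \<subseteq> circle"
  shows "capacity M E \<le> emeasure circle_measure (circle \<inter> {\<zeta>. infdist \<zeta> E < 1 / 4 ^ k0})
     + dirichlet_integral M (test_function E c {k0..m})"
proof -
  interpret \<sigma>: finite_circle_measure circle_measure by (rule finite_circle_measure_circle_measure)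
  let ?u = "test_function E c {k0..m}"
  let ?A = "circle \<inter> {\<zeta>. infdist \<zeta> E < 1 / 4 ^ k0}"
  \<comment> \<open>On half of the finest scale every bump equals 1, so the sum there is the total
    weight.\<close>
  define U where "U = circle \<inter> {\<zeta>. infdist \<zeta> E < 1 / 4 ^ m / 2}"
  define v where "v \<zeta> = (\<Sum>k=k0..m. c k * bump (1 / 4 ^ k) (infdist \<zeta> E))" for \<zeta>
  have u: "?u \<zeta> = of_real (v \<zeta>)" for \<zeta> by (simp add: test_function_def v_def)
  have v0: "0 \<le> v \<zeta>" for \<zeta> unfolding v_def using c by (intro sum_nonneg mult_nonneg_nonneg bump_nonneg)
  have v1: "v \<zeta> \<le> 1" for \<zeta>
  proof -
    have "v \<zeta> \<le> (\<Sum>k=k0..m. c k * 1)" unfolding v_def using c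
      by (intro sum_mono mult_left_mono bump_le_1) auto
    then show ?thesis using c1 by simp
  qed
  have vout: "v \<zeta> = 0" if "1 / 4 ^ k0 \<le> infdist \<zeta> E" for \<zeta>
    unfolding v_def
  proof (rule sum.neutral, rule ballI)
    fix k assume "k \<in> {k0..m}"
    then have "1 / 4 ^ k \<le> (1 / 4 ^ k0 :: real)" by (intro divide_left_mono power_increasing) auto
    then show "c k * bump (1 / 4 ^ k) (infdist \<zeta> E) = 0" using that by (subst bump_eq_0) auto
  qed
  have vin: "v \<zeta> = 1" if "\<zeta> \<in> U" for \<zeta>
  proof -
    have "v \<zeta> = (\<Sum>k=k0..m. c k * 1)" unfolding v_def
    proof (intro sum.cong refl)
      fix k assume "k \<in> {k0..m}"
      then have "1 / 4 ^ m \<le> (1 / 4 ^ k :: real)" by (intro divide_left_mono power_increasing) auto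
      then show "c k * bump (1 / 4 ^ k) (infdist \<zeta> E) = c k * 1"
        using that by (subst bump_eq_1) (auto simp: U_def)
    qed
    then show ?thesis using c1 by simp
  qed
  have L2: "(\<integral>\<^sup>+\<zeta>. ennreal ((cmod (?u \<zeta>))\<^sup>2) \<partial>circle_measure) \<le> emeasure circle_measure ?A"
  proof -
    have "(\<integral>\<^sup>+\<zeta>. ennreal ((cmod (?u \<zeta>))\<^sup>2) \<partial>circle_measure) \<le> (\<integral>\<^sup>+\<zeta>. indicator ?A \<zeta> \<partial>circle_measure)"
    proof (rule nn_integral_mono)
      fix \<zeta> assume "\<zeta> \<in> space circle_measure"
      then show "ennreal ((cmod (?u \<zeta>))\<^sup>2) \<le> indicator ?A \<zeta>"
        using v0[of \<zeta>] v1[of \<zeta>] vout[of \<zeta>] by (auto simp: u indicator_def power_le_one)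
    qed
    also have "\<dots> = emeasure circle_measure ?A" by (rule nn_integral_indicator) (rule \<sigma>.sets_M_I, measurable)
    finally show ?thesis .
  qed
  have L2fin: "emeasure circle_measure ?A < \<infinity>" by (simp add: less_top[symmetric])
  have norm: "dirichlet_norm_sq M ?u \<le> emeasure circle_measure ?A + dirichlet_integral M ?u"
    unfolding dirichlet_norm_sq_def by (rule add_right_mono[OF L2])
  have "?u \<in> borel_measurable circle_measure"
    using lipschitz_on_continuous_on[OF lipschitz_on_test_function, of "{k0..m}" c UNIV E] c
    by (intro measurable_circle_measureI borel_measurable_continuous_onI) auto
  then have "?u \<in> L2_circle" using le_less_trans[OF L2 L2fin] by (simp add: L2_circle_def)
  moreover have "dirichlet_norm_sq M ?u < \<infinity>" using le_less_trans[OF norm] L2fin fin by simp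
  ultimately have space: "?u \<in> harmonic_dirichlet_space M" by (simp add: harmonic_dirichlet_space_def)
  have "capacity M E \<le> open_capacity M U"
    unfolding capacity_def
  proof (rule Inf_lower, rule CollectI, intro exI conjI)
    have "open {\<zeta>. infdist \<zeta> E < 1 / 4 ^ m / 2}" by (intro open_Collect_less continuous_intros)
    then show "openin (top_of_set circle) U" by (auto simp: U_def openin_open)
    show "E \<subseteq> U" using E by (auto simp: U_def)
  qed simp
  also have "\<dots> \<le> dirichlet_norm_sq M ?u"
    unfolding open_capacity_def
    by (rule Inf_lower, rule CollectI, intro exI[of _ ?u] conjI refl space)
       (use v0 vin in \<open>auto simp: u less_eq_complex_def\<close>)
  also note norm
  finally show ?thesis .
qed

text \<open>A separate case because \<open>infdist \<zeta> {} = 0\<close>, so that the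
  neighbourhoods of the empty set would be the whole circle. The zero function is recognised as the
  empty test function.\<close>

lemma capacity_empty: "capacity M {} = 0"
proof -
  have z: "test_function {} (\<lambda>_. 0) {} = (\<lambda>_. 0)" by (simp add: test_function_def fun_eq_iff)
  have "dirichlet_integral M (\<lambda>_. 0) \<le> 0"
    using dirichlet_integral_test_function_le[of "{}" "\<lambda>_. 0" "{}"] by (simp add: z)
  then have n: "dirichlet_norm_sq M (\<lambda>_. 0) = 0" by (simp add: dirichlet_norm_sq_def)
  then have "(\<lambda>_. 0) \<in> harmonic_dirichlet_space M"
    by (simp add: harmonic_dirichlet_space_def L2_circle_def)
  then have "open_capacity M {} \<le> dirichlet_norm_sq M (\<lambda>_. 0)"
    unfolding open_capacity_def by (intro Inf_lower CollectI exI[of _ "\<lambda>_. 0"]) auto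
  moreover have "capacity M {} \<le> open_capacity M {}"
    unfolding capacity_def by (intro Inf_lower CollectI exI[of _ "{}"]) auto
  ultimately show ?thesis using n by simp
qed

lemma capacity_eq_0:
  assumes E: "E \<subseteq> circle" "closed E" and null: "emeasure circle_measure E = 0"
    and div: "(\<integral>\<^sup>+t\<in>{0<..<pi}. 1 / gap_weight M E t \<partial>lborel) = \<infinity>"
  shows "capacity M E = 0"
proof (cases "E = {}")
  case True then show ?thesis by (simp add: capacity_empty)
next
  case ne: False
  have "capacity M E \<le> 0 + ennreal e" if e: "e > 0" for e
  proof -
    let ?A = "\<lambda>n. circle \<inter> {\<zeta>. infdist \<zeta> E < 1 / 4 ^ n}"
    \<comment> \<open>The coarsest scale \<open>k0\<close> is fixed first, so that the
      \<open>L\<^sup>2\<close> part stays below \<open>e/2\<close> for any choice of weights. As the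
      series still diverges from \<open>k0\<close> on, the weights can then push the Dirichlet
      integral below \<open>e/2\<close>.\<close>
    have "\<forall>\<^sub>F n in sequentially. emeasure circle_measure (?A n) < ennreal (e/2)"
      using emeasure_neighbourhoods_tendsto_0[OF E(2) ne E(1) null] e by (intro order_tendstoD(2)) auto
    then obtain k0 where k0: "emeasure circle_measure (?A k0) < ennreal (e/2)"
      by (meson eventually_happens' sequentially_bot)
    let ?C = "12288 * pi ^ 4"
    have div': "(\<Sum>i. 1 / (gap_weight M E (1 / 4 ^ (k0 + i)) * ennreal (4 ^ (k0 + i)))) = \<infinity>"
      by (rule condensation_divergent[OF _ div]) (rule gap_weight_mono)
    have pos: "e / 2 / ?C > 0" using e by simp
    obtain m c where c: "\<And>k. 0 \<le> c k" "(\<Sum>k=k0..m. c k) = 1"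
      and le: "(\<Sum>k=k0..m. ennreal ((c k)\<^sup>2) * (gap_weight M E (1 / 4 ^ k) * ennreal (4 ^ k))) \<le> ennreal (e / 2 / ?C)"
      by (rule weights_of_divergent_series[OF div' pos])
         (rule that, assumption+)
    have "dirichlet_integral M (test_function E c {k0..m})
      \<le> ennreal ?C * (\<Sum>k=k0..m. ennreal ((c k)\<^sup>2) * (gap_weight M E (1 / 4 ^ k) * ennreal (4 ^ k)))"
      using E ne null c by (intro dirichlet_integral_test_function_le_gap_weight) auto
    also have "\<dots> \<le> ennreal ?C * ennreal (e / 2 / ?C)" using le by (rule mult_left_mono) simp
    also have "\<dots> = ennreal (e / 2)" using e by (subst ennreal_mult[symmetric]) auto
    finally have D: "dirichlet_integral M (test_function E c {k0..m}) \<le> ennreal (e / 2)" .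
    then have "dirichlet_integral M (test_function E c {k0..m}) < \<infinity>" by (rule le_less_trans) simp
    from capacity_le_test_function[OF c this E(1)]
    have "capacity M E \<le> emeasure circle_measure (?A k0) + dirichlet_integral M (test_function E c {k0..m})" .
    also have "\<dots> \<le> ennreal (e/2) + ennreal (e/2)" using k0 D by (intro add_mono) auto
    also have "\<dots> = 0 + ennreal e" using e by (simp flip: ennreal_plus)
    finally show ?thesis .
  qed
  then have "capacity M E \<le> 0" by (rule ennreal_le_epsilon)
  then show ?thesis by simp
qed

end

theorem mainTheorem4:
  fixes \<mu> :: "complex measure" and E :: "complex set"
  assumes "finite_measure \<mu>"
    and "sets \<mu> = sets (restrict_space borel circle)"
    and "E \<subseteq> circle"
    and "closed E"
    and "emeasure circle_measure E = 0"
    and "(\<integral>\<^sup>+ t\<in>{0<..<pi}.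
            1 / (\<integral>\<^sup>+ s\<in>{0<..<t}. modulus_of_continuity \<mu> s * gap_counting E s / ennreal s \<partial>lborel)
          \<partial>lborel) = \<infinity>"
  shows "capacity \<mu> E = 0"
proof -
  interpret finite_circle_measure \<mu>
    using assms(1,2) by (intro finite_circle_measure.intro finite_circle_measure_axioms.intro)
  show ?thesis
    using assms(3-6) by (intro capacity_eq_0) (simp_all add: gap_weight_def)
qed

end
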